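(* Let $1<p<\infty$ and let $f\in L_1([-\pi,\pi])$ have Fourier series $\sum_{k=-\infty}^{\infty}a_ke^{ikx}$. If $a=\{a_k\}_{k\in\mathbb Z}\in\mathrm{GM}^*$, then $$\|f\|_{L_p([-\pi,\pi])}\asymp J_p^*(f),$$ i.e. there are constants $0<c_1\le c_2<\infty$ depending only on $p$ and on the constant $C$ in the definition of $\mathrm{GM}^*$ such that $c_1J_p^*(f)\le\|f\|_{L_p}\le c_2J_p^*(f)$ (both sides being simultaneously finite or infinite).
   Context: For a two-sided sequence $a=\{a_k\}_{k\in\mathbb Z}$ of complex numbers put $|\Delta a_k|=|a_k-a_{k+1}|$ for $k>0$, $|\Delta a_k|=|a_k-a_{k-1}|$ for $k<0$, and $|\Delta a_0|=|a_0-a_1|+|a_0-a_{-1}|$. An interval in $\mathbb Z$ is a finite nonempty set of consecutive integers; $\mathcal W$ denotes the set of all intervals and $|w|$ the cardinality of $w\in\mathcal W$. For $k\in\mathbb N$, $\widetilde a_k=\sup_{w\in\mathcal W,\ |w|\ge k}\frac1{|w|}\big|\sum_{j\in w}a_j\big|$. $[x]$ denotes the floor function (so $[2^{n-1}]=2^{n-1}$ for $n\ge1$ and $[2^{-1}]=0$). The sequence $a$ belongs to $\mathrm{GM}^*$ if there is $C>0$ such that for every $n\ge0$, $$\sum_{[2^{n-1}]\le|m|<2^n}|\Delta a_m|\le C\sup_{k\in\mathbb N_0}\min(1,2^{k-n})\,\widetilde a_{2^k}.$$ The Fourier coefficients are $a_k=\frac1{2\pi}\int_{-\pi}^{\pi}f(x)e^{-ikx}\,dx$.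 Let $\{a_k^*\}_{k\in\mathbb Z}$ be the symmetric nonincreasing rearrangement of $\{|a_k|\}_{k\in\mathbb Z}$, i.e. the values $|a_k|$ rearranged in nonincreasing order and placed so that $a_0^*\ge a_{-1}^*\ge a_1^*\ge a_{-2}^*\ge a_2^*\ge\cdots$. Define $J_p^*(f)=\big(\sum_{k\in\mathbb Z}(|k|+1)^{p-2}(a_k^* )^p\big)^{1/p}$. *)

theory Defs
  imports "HOL-Analysis.Analysis"
begin

definition fourier_coeff :: "(real \<Rightarrow> complex) \<Rightarrow> int \<Rightarrow> complex" where
  "fourier_coeff f k =
     (LINT x:{-pi..pi}|lborel. f x * exp (- (\<i> * of_int k * complex_of_real x))) / complex_of_real (2 * pi)"

definition Delta_abs :: "(int \<Rightarrow> complex) \<Rightarrow> int \<Rightarrow> real" where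
  "Delta_abs a k =
     (if k > 0 then norm (a k - a (k + 1))
      else if k < 0 then norm (a k - a (k - 1))
      else norm (a 0 - a 1) + norm (a 0 - a (-1)))"

definition atilde :: "(int \<Rightarrow> complex) \<Rightarrow> nat \<Rightarrow> ereal" where
  "atilde a k =
     (SUP w \<in> {(i, j). i \<le> j \<and> k \<le> nat (j - i + 1)}.
        ereal (norm (\<Sum>l\<in>{fst w..snd w}. a l) / real_of_int (snd w - fst w + 1)))"

definition GM_star :: "real \<Rightarrow> (int \<Rightarrow> complex) \<Rightarrow> bool" where
  "GM_star C a \<longleftrightarrow> C > 0 \<and>
     (\<forall>n::nat.
        ereal (\<Sum>m\<in>{m::int. \<lfloor>2 powr (real n - 1)\<rfloor> \<le> \<bar>m\<bar> \<and> \<bar>m\<bar> < 2 ^ n}. Delta_abs a m)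
        \<le> ereal C * (SUP k::nat. ereal (min 1 (2 powr (real k - real n))) * atilde a (2 ^ k)))"

definition decr_rearr :: "(int \<Rightarrow> complex) \<Rightarrow> nat \<Rightarrow> real" where
  "decr_rearr a n =
     Inf {t::real. 0 \<le> t \<and> finite {k::int. norm (a k) > t} \<and> card {k::int. norm (a k) > t} \<le> n}"

text \<open>Symmetric nonincreasing rearrangement, placed in the order
  a*_0 >= a*_{-1} >= a*_1 >= a*_{-2} >= a*_2 >= ...\<close>
definition sym_rearr :: "(int \<Rightarrow> complex) \<Rightarrow> int \<Rightarrow> real" where
  "sym_rearr a k = (if k \<ge> 0 then decr_rearr a (nat (2 * k)) else decr_rearr a (nat (2 * \<bar>k\<bar> - 1)))"

definition J_star :: "real \<Rightarrow> (real \<Rightarrow> complex) \<Rightarrow> real" where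
  "J_star p f = (\<Sum>\<^sub>\<infinity>k\<in>UNIV. (real_of_int \<bar>k\<bar> + 1) powr (p - 2) * sym_rearr (fourier_coeff f) k powr p) powr (1 / p)"

definition J_star_finite :: "real \<Rightarrow> (real \<Rightarrow> complex) \<Rightarrow> bool" where
  "J_star_finite p f \<longleftrightarrow>
     (\<lambda>k. (real_of_int \<bar>k\<bar> + 1) powr (p - 2) * sym_rearr (fourier_coeff f) k powr p) summable_on (UNIV :: int set)"

definition Lp_finite :: "real \<Rightarrow> (real \<Rightarrow> complex) \<Rightarrow> bool" where
  "Lp_finite p f \<longleftrightarrow> set_integrable lborel {-pi..pi} (\<lambda>x. norm (f x) powr p)"

definition Lp_norm :: "real \<Rightarrow> (real \<Rightarrow> complex) \<Rightarrow> real" where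
  "Lp_norm p f = (LINT x:{-pi..pi}|lborel. norm (f x) powr p) powr (1 / p)"

end

theory Submission
  imports Defs
begin

text \<open>
  Everything is compared with the sequence of dyadic suprema of averages of the Fourier coefficients.
  Put \<open>1/p + 1/p' = 1\<close> and call a sequence admissible if, multiplied by \<open>2\<^sup>n\<^sup>/\<^sup>p\<^sup>'\<close>, it lies in \<open>l\<^sup>p\<close>.
  If \<open>f\<close> is in \<open>L\<^sub>p\<close>, the kernel bound \<open>min (|w|, \<pi>/|x|)\<close> for the exponential sum over an interval \<open>w\<close>
  majorizes the averages over \<open>|w| \<ge> 2\<^sup>n\<close> by a sum over the shells \<open>\<pi>/2\<^sup>m\<^sup>+\<^sup>1 < |x| \<le> \<pi>/2\<^sup>m\<close>; if \<open>J\<^sub>p\<^sup>*\<close> is finite, they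
  are majorized by averages of the decreasing rearrangement.  Both majorants are admissible.
  The condition \<open>GM\<^sup>*\<close> transfers admissibility from averages to the block variations, hence to the tails
  \<open>B\<^sub>n\<close> of the variation, which also dominate \<open>|a\<^sub>k|\<close> for \<open>|k| \<ge> 2\<^sup>n\<^sup>-\<^sup>1\<close>.  Admissibility of \<open>B\<close>
  bounds \<open>J\<^sub>p\<^sup>*\<close> by condensation, and bounds the \<open>L\<^sub>p\<close> norm because Abel summation gives
  \<open>|S\<^sub>N(x)| \<le> 9 (\<Sum>j\<le>n. 2\<^sup>j B\<^sub>j)\<close> on the \<open>n\<close>-th shell; the partial sums converge to \<open>f\<close> almost everywhere by
  dominated convergence and uniqueness of Fourier coefficients.
  Each transfer is an instance of Schur's test for a kernel \<open>2\<^sup>-\<^sup>d\<^sup>|\<^sup>n\<^sup>-\<^sup>m\<^sup>|\<close>.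
\<close>

section \<open>Schur test for exponentially decaying kernels\<close>

text \<open>The weight \<open>2^(n/p')\<close> is forced from both ends. A value v on 2^n indices of
  size about 2^n contributes about \<open>2^(n(p-2)) * 2^n * v^p = (2^(n/p') v)^p\<close> to the
  p-th power of the rearranged norm, and a partial sum of size \<open>2^n v\<close> on a shell of
  measure \<open>pi/2^n\<close> contributes pi times the same number to the integral. Against this
  weight the factor \<open>min(1, 2^(k-n))\<close> of the hypothesis decays at rate 1/p for k <= n
  and 1/p' for k >= n; both rates are positive exactly when 1 < p < infinity. The obstacle is
  finiteness: the suprema of averages are extended reals, and neither their finiteness nor any decay
  of the coefficients is known at the start. So averages enter only through real majorants
  \<open>R\<close> whose weighted p-th powers are proved summable, and every transfer delivers
  summability together with its estimate. This is how the simultaneous finiteness of the two norms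
  comes out.\<close>

definition kern :: "real \<Rightarrow> nat \<Rightarrow> nat \<Rightarrow> real" where
  "kern d n m = 2 powr (- d * \<bar>real n - real m\<bar>)"

lemma kern_nonneg [simp]: "0 \<le> kern d n m"
  by (simp add: kern_def)

lemma kern_commute: "kern d n m = kern d m n"
  by (simp add: kern_def abs_minus_commute)

lemma kern_le_1: "0 \<le> d \<Longrightarrow> kern d n m \<le> 1"
  unfolding kern_def using powr_mono[of "- d * \<bar>real n - real m\<bar>" 0 2] by simp

lemma kern_split: "kern d n m = kern (d / 2) n m * kern (d / 2) n m"
  by (simp add: kern_def flip: powr_add)

lemma kern_powr: "kern d n m powr p = kern (d * p) n m"
  by (simp add: kern_def powr_powr algebra_simps)

lemma kern_sum_bound:
  assumes "0 < d"
  shows "(\<Sum>n<N. kern d n m) \<le> 2 / (1 - 2 powr (- d))"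
proof -
  define q where "q = 2 powr (- d)"
  have q: "0 < q" "q < 1"
    using assms by (auto simp: q_def powr_less_one)
  have geo: "(\<Sum>n<M. q ^ n) \<le> 1 / (1 - q)" for M
    using q by (simp add: sum_gp_strict field_simps)
  \<comment> \<open>The range is enlarged so that it splits at the diagonal \<open>n = m\<close>
    whatever the order of \<open>N\<close> and \<open>m\<close>; each side is a geometric
    series.\<close>
  have "(\<Sum>n<N. kern d n m) \<le> (\<Sum>n<m + N. kern d n m)"
    by (rule sum_mono2) auto
  also have "\<dots> = (\<Sum>n<m. kern d n m) + (\<Sum>n<N. kern d (m + n) m)"
    by (induction N) auto
  also have "(\<Sum>n<N. kern d (m + n) m) = (\<Sum>n<N. q ^ n)"
    by (intro sum.cong) (auto simp: kern_def q_def powr_realpow[symmetric] powr_powr)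
  also have "(\<Sum>n<m. kern d n m) = (\<Sum>n<m. kern d (m - Suc n) m)"
    by (rule sum.nat_diff_reindex[symmetric])
  also have "\<dots> \<le> (\<Sum>n<m. q ^ n)"
  proof (rule sum_mono)
    fix n assume "n \<in> {..<m}"
    then have "kern d (m - Suc n) m = q ^ Suc n"
      by (simp add: kern_def q_def powr_realpow[symmetric] powr_powr of_nat_diff algebra_simps flip: powr_add)
    then show "kern d (m - Suc n) m \<le> q ^ n"
      using q by (simp add: mult_left_le_one_le)
  qed
  finally show ?thesis
    using geo[of m] geo[of N] by (simp add: q_def)
qed

lemma kern_summable:
  assumes "0 < d"
  shows "summable (kern d n)" and "suminf (kern d n) \<le> 2 / (1 - 2 powr (- d))"
proof -
  have *: "(\<Sum>m<N. kern d n m) \<le> 2 / (1 - 2 powr (- d))" for N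
    using kern_sum_bound[OF assms, of n N] by (subst kern_commute)
  show "summable (kern d n)"
    by (rule summableI_nonneg_bounded[OF _ *]) simp
  then show "suminf (kern d n) \<le> 2 / (1 - 2 powr (- d))"
    by (rule suminf_le_const[OF _ *])
qed

text \<open>A sequence with summable p-th powers is bounded by the p-th root of their sum, so a
  constant multiple of the summable kernel row dominates.\<close>

lemma kern_mult_summable:
  assumes "0 < d" "0 < p" "\<And>m. 0 \<le> b m" "summable (\<lambda>m. b m powr p)"
  shows "summable (\<lambda>m. kern d n m * b m)"
proof -
  define S where "S = (\<Sum>m. b m powr p)"
  have b: "b m \<le> S powr (1 / p)" for m
  proof -
    have "b m powr p \<le> S"
      unfolding S_def using sum_le_suminf[OF assms(4), of "{m}"] by simp
    then have "(b m powr p) powr (1 / p) \<le> S powr (1 / p)"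
      using assms by (intro powr_mono2) auto
    then show ?thesis using assms by (simp add: powr_powr)
  qed
  show ?thesis
  proof (rule summable_comparison_test')
    show "summable (\<lambda>m. kern d n m * S powr (1 / p))"
      by (intro summable_mult2 kern_summable assms)
    show "norm (kern d n m * b m) \<le> kern d n m * S powr (1 / p)" for m
      using b[of m] assms by (simp add: mult_left_mono)
  qed
qed

text \<open>The square root of the kernel absorbs the summation, so that each row is controlled by a
  single weighted \<open>l\<^sup>p\<close> sum; this replaces Jensen's inequality in Schur's test.\<close>

lemma kern_schur:
  assumes d: "0 < d" and p: "0 < p"
  shows "\<exists>K>0. \<forall>b. (\<forall>m. 0 \<le> b m) \<longrightarrow> summable (\<lambda>m. b m powr p) \<longrightarrow>
       summable (\<lambda>n. (\<Sum>m. kern d n m * b m) powr p) \<and>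
       (\<Sum>n. (\<Sum>m. kern d n m * b m) powr p) \<le> K * (\<Sum>m. b m powr p)"
proof -
  define L where "L = 2 / (1 - 2 powr (- (d / 2)))"
  define L' where "L' = 2 / (1 - 2 powr (- (d / 2 * p)))"
  have pos: "0 < L" "0 < L'"
    using d p by (auto simp: L_def L'_def powr_less_one)
  have main: "summable (\<lambda>n. (\<Sum>m. kern d n m * b m) powr p) \<and>
       (\<Sum>n. (\<Sum>m. kern d n m * b m) powr p) \<le> L powr p * L' * (\<Sum>m. b m powr p)"
    if b: "\<And>m. 0 \<le> b m" and sb: "summable (\<lambda>m. b m powr p)" for b :: "nat \<Rightarrow> real"
  proof -
    \<comment> \<open>A single term of a nonnegative series is at most its sum, so
      \<open>y n\<close> bounds the p-th power of every \<open>kern (d / 2) n m * b m\<close> in row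
      \<open>n\<close>. The other half of the kernel then sums to at most \<open>L\<close>.\<close>
    define y where "y n = (\<Sum>m. kern (d / 2 * p) n m * b m powr p)" for n
    have sy: "summable (\<lambda>m. kern (d / 2 * p) n m * b m powr p)" for n
    proof (rule summable_comparison_test'[OF sb])
      show "norm (kern (d / 2 * p) n m * b m powr p) \<le> b m powr p" for m
        using d p by (simp add: kern_le_1 mult_left_le_one_le)
    qed
    have y0: "0 \<le> y n" for n
      unfolding y_def by (intro suminf_nonneg sy) auto
    have row: "(\<Sum>m. kern d n m * b m) powr p \<le> L powr p * y n" for n
    proof -
      have *: "kern (d / 2) n m * b m \<le> y n powr (1 / p)" for m
      proof -
        have "(kern (d / 2) n m * b m) powr p \<le> y n"
          using sum_le_suminf[OF sy[of n], of "{m}"] b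
          by (simp add: y_def powr_mult kern_powr)
        then have "((kern (d / 2) n m * b m) powr p) powr (1 / p) \<le> y n powr (1 / p)"
          using p by (intro powr_mono2) auto
        then show ?thesis using p b by (simp add: powr_powr)
      qed
      have "(\<Sum>m. kern d n m * b m) \<le> (\<Sum>m. kern (d / 2) n m * y n powr (1 / p))"
      proof (rule suminf_le)
        show "kern d n m * b m \<le> kern (d / 2) n m * y n powr (1 / p)" for m
          using mult_left_mono[OF *[of m], of "kern (d / 2) n m"]
          by (subst kern_split) (simp add: mult.assoc)
      qed (use d p b sb in \<open>auto intro: kern_mult_summable summable_mult2[OF kern_summable(1)]\<close>)
      also have "\<dots> = suminf (kern (d / 2) n) * y n powr (1 / p)"
        using d by (intro suminf_mult2[symmetric] kern_summable) auto
      also have "\<dots> \<le> L * y n powr (1 / p)"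
        using d kern_summable(2)[of "d / 2" n] by (intro mult_right_mono) (auto simp: L_def)
      finally have "(\<Sum>m. kern d n m * b m) powr p \<le> (L * y n powr (1 / p)) powr p"
        using p d b sb by (intro powr_mono2 suminf_nonneg kern_mult_summable) auto
      also have "\<dots> = L powr p * y n"
        using p pos y0[of n] by (simp add: powr_mult powr_powr)
      finally show ?thesis .
    qed
    \<comment> \<open>Restricting to finitely many rows makes the exchange of summations one of a
      finite with an infinite sum; the columns of the remaining kernel sum to at most
      \<open>L'\<close>.\<close>
    have part: "(\<Sum>n<N. (\<Sum>m. kern d n m * b m) powr p) \<le> L powr p * L' * (\<Sum>m. b m powr p)" for N
    proof -
      have "(\<Sum>n<N. (\<Sum>m. kern d n m * b m) powr p) \<le> L powr p * (\<Sum>n<N. y n)"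
        unfolding sum_distrib_left by (intro sum_mono row)
      also have "(\<Sum>n<N. y n) = (\<Sum>m. \<Sum>n<N. kern (d / 2 * p) n m * b m powr p)"
        unfolding y_def using sy by (intro suminf_sum[symmetric]) auto
      also have "\<dots> \<le> (\<Sum>m. L' * b m powr p)"
      proof (rule suminf_le)
        show "(\<Sum>n<N. kern (d / 2 * p) n m * b m powr p) \<le> L' * b m powr p" for m
          unfolding sum_distrib_right[symmetric] L'_def
          using d p by (intro mult_right_mono kern_sum_bound) auto
      qed (use sy sb in \<open>auto intro!: summable_sum summable_mult\<close>)
      also have "\<dots> = L' * (\<Sum>m. b m powr p)"
        using sb by (rule suminf_mult)
      finally show ?thesis by (simp add: mult.assoc mult_left_mono)
    qed
    have "summable (\<lambda>n. (\<Sum>m. kern d n m * b m) powr p)"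
      by (rule summableI_nonneg_bounded[OF _ part]) simp
    then show ?thesis using suminf_le_const[OF _ part] by blast
  qed
  show ?thesis
    by (rule exI[of _ "L powr p * L'"]) (use pos main in auto)
qed

text \<open>Carries the conclusion of Schur's test over to a dominated sequence. A bound of the form
  \<open>z n <= c * y n\<close> enters with \<open>x n = z n / c\<close>.\<close>

lemma suminf_powr_le:
  fixes x y :: "nat \<Rightarrow> real" and p c :: real
  assumes p: "0 < p" and x: "\<And>n. 0 \<le> x n" "\<And>n. x n \<le> y n" and c: "0 \<le> c"
    and y: "summable (\<lambda>n. y n powr p)" "(\<Sum>n. y n powr p) \<le> S"
  shows "summable (\<lambda>n. (c * x n) powr p) \<and> (\<Sum>n. (c * x n) powr p) \<le> c powr p * S"
proof -
  have le: "(c * x n) powr p \<le> c powr p * y n powr p" for n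
    using p x[of n] c powr_mono2[of p "x n" "y n"] by (simp add: powr_mult mult_left_mono)
  have s: "summable (\<lambda>n. c powr p * y n powr p)"
    by (intro summable_mult y)
  have s2: "summable (\<lambda>n. (c * x n) powr p)"
    by (rule summable_comparison_test'[OF s]) (use le in auto)
  have "(\<Sum>n. (c * x n) powr p) \<le> (\<Sum>n. c powr p * y n powr p)"
    by (intro suminf_le le s s2)
  also have "\<dots> = c powr p * (\<Sum>n. y n powr p)"
    by (intro suminf_mult y)
  also have "\<dots> \<le> c powr p * S"
    using y by (intro mult_left_mono) auto
  finally show ?thesis using s2 by blast
qed

text \<open>For \<open>m <= n\<close> the exponents on the left add up to
  \<open>-(1 - th) * (n - m)\<close>, for \<open>m > n\<close> the minimum is at most 1 and
  \<open>-th * (m - n)\<close> remains; \<open>d\<close> must stay below both rates.\<close>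

lemma kern_min:
  assumes "0 < d" "d \<le> th" "d \<le> 1 - th"
  shows "2 powr (th * (real n - real m)) * min 1 (2 powr (real m - real n)) \<le> kern d n m"
proof (cases "m \<le> n")
  case True
  then have "min 1 (2 powr (real m - real n)) = 2 powr (real m - real n)"
    using powr_mono[of "real m - real n" 0 2] by simp
  moreover have "th * (real n - real m) + (real m - real n) \<le> - d * \<bar>real n - real m\<bar>"
    using True mult_right_mono[of d "1 - th" "real n - real m"] assms by (simp add: algebra_simps)
  ultimately show ?thesis
    by (simp add: kern_def flip: powr_add)
next
  case False
  then have "2 powr (th * (real n - real m)) * min 1 (2 powr (real m - real n)) \<le> 2 powr (th * (real n - real m)) * 1"
    by (intro mult_left_mono) auto
  moreover have "th * (real n - real m) \<le> - d * \<bar>real n - real m\<bar>"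
    using False mult_right_mono[of d "th" "real m - real n"] assms by (simp add: algebra_simps)
  then have "2 powr (th * (real n - real m)) \<le> kern d n m"
    unfolding kern_def by (intro powr_mono) auto
  ultimately show ?thesis by linarith
qed

section \<open>From averages to tails of the variation\<close>

text \<open>With \<open>1/p + 1/p' = 1\<close>, \<open>wt p n\<close> is \<open>2\<^sup>n\<^sup>/\<^sup>p\<^sup>'\<close>.  All quantities attached to the dyadic level \<open>n\<close> are
  compared in \<open>l\<^sup>p\<close> after multiplication by this weight.\<close>

definition wt :: "real \<Rightarrow> nat \<Rightarrow> real" where
  "wt p n = 2 powr ((1 - 1 / p) * real n)"

text \<open>The smaller of the two rates in \<open>kern_min\<close> when \<open>th\<close> is the
  weight exponent \<open>1 - 1 / p\<close>.\<close>

definition decay :: "real \<Rightarrow> real" where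
  "decay p = min (1 / p) (1 - 1 / p)"

lemma decay_pos: "1 < p \<Longrightarrow> 0 < decay p"
  by (simp add: decay_def)

lemma wt_pos [simp]: "0 < wt p n"
  by (simp add: wt_def)

lemma wt_nonneg [simp]: "0 \<le> wt p n"
  by (simp add: wt_def)

lemma wt_neq_0 [simp]: "wt p n \<noteq> 0"
  by (simp add: wt_def)

lemma wt_ge_1: "1 < p \<Longrightarrow> 1 \<le> wt p n"
  unfolding wt_def by (rule ge_one_powr_ge_zero) auto

lemma wt_kern_min:
  assumes "1 < p"
  shows "wt p n * min 1 (2 powr (real m - real n)) \<le> kern (decay p) n m * wt p m"
proof -
  have "wt p n = 2 powr ((1 - 1 / p) * (real n - real m)) * wt p m"
    by (simp add: wt_def algebra_simps flip: powr_add)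
  then have "wt p n * min 1 (2 powr (real m - real n)) =
      2 powr ((1 - 1 / p) * (real n - real m)) * min 1 (2 powr (real m - real n)) * wt p m"
    by (simp only: ac_simps)
  also have "\<dots> \<le> kern (decay p) n m * wt p m"
    by (intro mult_right_mono kern_min decay_pos assms) (auto simp: decay_def)
  finally show ?thesis .
qed

lemma wt_powr: "0 < p \<Longrightarrow> wt p n powr p = 2 powr ((p - 1) * real n)"
  by (simp add: wt_def powr_powr algebra_simps)

text \<open>Truncating division gives the floor for every \<open>n\<close>, with value 0 at
  \<open>n = 0\<close>. This is why \<open>2 ^ n div 2\<close> is the lower end of the n-th block
  throughout.\<close>

lemma floor_half_power: "\<lfloor>2 powr (real n - 1)\<rfloor> = int (2 ^ n div 2)"
proof (cases n)
  case 0
  then show ?thesis by (simp add: powr_minus)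
next
  case (Suc m)
  then have "2 powr (real n - 1) = real (2 ^ m)"
    by (simp add: powr_realpow)
  then have "\<lfloor>2 powr (real n - 1)\<rfloor> = int (2 ^ m)"
    by (metis floor_of_nat)
  then show ?thesis using Suc by simp
qed

definition block_var :: "(int \<Rightarrow> complex) \<Rightarrow> nat \<Rightarrow> real" where
  "block_var a n = (\<Sum>m\<in>{m::int. int (2 ^ n div 2) \<le> \<bar>m\<bar> \<and> \<bar>m\<bar> < 2 ^ n}. Delta_abs a m)"

lemma Delta_abs_nonneg: "0 \<le> Delta_abs a m"
  by (simp add: Delta_abs_def)

lemma block_var_nonneg: "0 \<le> block_var a n"
  by (simp add: block_var_def Delta_abs_nonneg sum_nonneg)

text \<open>The sign \<open>s\<close> selects a half-line, parametrised by the modulus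
  \<open>j\<close>, so one argument serves both sides. At \<open>j = 0\<close> the term
  \<open>Delta_abs a 0\<close> contains the differences in both directions and dominates either
  one.\<close>

lemma side_block_le:
  assumes s: "s = 1 \<or> s = (-1::int)"
  shows "(\<Sum>j\<in>{2 ^ n div 2..<2 ^ n}. norm (a (s * int j) - a (s * int (Suc j)))) \<le> block_var a n"
proof -
  have fin: "finite {m::int. int (2 ^ n div 2) \<le> \<bar>m\<bar> \<and> \<bar>m\<bar> < 2 ^ n}"
    by (rule finite_subset[of _ "{-(2^n)..2^n}"]) auto
  have "(\<Sum>j\<in>{2 ^ n div 2..<2 ^ n}. norm (a (s * int j) - a (s * int (Suc j))))
      \<le> (\<Sum>j\<in>{2 ^ n div 2..<2 ^ n}. Delta_abs a (s * int j))"
  proof (rule sum_mono)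
    fix j
    have "s * int (Suc j) = s * int j + s" by (simp add: algebra_simps)
    moreover have "norm (a (s * int j) - a (s * int j + s)) \<le> Delta_abs a (s * int j)"
      using s by (auto simp: Delta_abs_def)
    ultimately show "norm (a (s * int j) - a (s * int (Suc j))) \<le> Delta_abs a (s * int j)"
      by simp
  qed
  also have "\<dots> = sum (Delta_abs a) ((\<lambda>j. s * int j) ` {2 ^ n div 2..<2 ^ n})"
    using s by (subst sum.reindex) (auto simp: inj_on_def)
  also have "\<dots> \<le> block_var a n"
    unfolding block_var_def
  proof (rule sum_mono2[OF fin])
    show "(\<lambda>j. s * int j) ` {2 ^ n div 2..<2 ^ n} \<subseteq> {m. int (2 ^ n div 2) \<le> \<bar>m\<bar> \<and> \<bar>m\<bar> < 2 ^ n}"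
      using s by (auto simp: abs_mult)
  qed (simp add: Delta_abs_nonneg)
  finally show ?thesis .
qed

text \<open>From radius \<open>2 ^ n div 2\<close> on, a half-line is tiled by the blocks n, n + 1,
  and so on; because \<open>N < 2 ^ N\<close>, the range up to \<open>N\<close> lies in finitely
  many of them.\<close>

lemma side_var_le:
  assumes s: "s = 1 \<or> s = (-1::int)" and sv: "summable (block_var a)" and M: "2 ^ n div 2 \<le> M"
  shows "(\<Sum>j\<in>{M..<N}. norm (a (s * int j) - a (s * int (Suc j)))) \<le> (\<Sum>i. block_var a (i + n))"
proof -
  let ?D = "\<lambda>j. norm (a (s * int j) - a (s * int (Suc j)))"
  have *: "sum ?D {2 ^ n div 2..<2 ^ (n + k)} \<le> (\<Sum>i<Suc k. block_var a (i + n))" for k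
  proof (induction k)
    case 0
    then show ?case using side_block_le[OF s, of a n] by simp
  next
    case (Suc k)
    have "2 ^ n div 2 \<le> (2::nat) ^ (n + k)"
      by (rule order_trans[of _ "2 ^ n"]) (auto intro: power_increasing)
    then have "sum ?D {2 ^ n div 2..<2 ^ (n + Suc k)} =
      sum ?D {2 ^ n div 2..<2 ^ (n + k)} + sum ?D {2 ^ (n + k)..<2 ^ (n + Suc k)}"
      by (intro sum.atLeastLessThan_concat[symmetric]) auto
    also have "\<dots> \<le> (\<Sum>i<Suc k. block_var a (i + n)) + block_var a (n + Suc k)"
      using Suc side_block_le[OF s, of a "n + Suc k"] by (intro add_mono) auto
    finally show ?case by (simp add: add.commute)
  qed
  have "sum ?D {M..<N} \<le> sum ?D {2 ^ n div 2..<2 ^ (n + N)}"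
  proof (rule sum_mono2)
    have "N < 2 ^ N" by (rule less_exp)
    also have "(2::nat) ^ N \<le> 2 ^ (n + N)" by (intro power_increasing) auto
    finally show "{M..<N} \<subseteq> {2 ^ n div 2..<2 ^ (n + N)}"
      using M by auto
  qed auto
  also have "\<dots> \<le> (\<Sum>i<Suc N. block_var a (i + n))" by (rule *)
  also have "\<dots> \<le> (\<Sum>i. block_var a (i + n))"
    using sv by (intro sum_le_suminf) (auto simp: block_var_nonneg summable_iff_shift)
  finally show ?thesis .
qed

text \<open>Multiplied-out form of \<open>R n\<close> being a real upper bound for the extended-real
  supremum \<open>atilde a (2 ^ n)\<close>. \<open>R\<close> is an arbitrary majorant because the
  two directions of the theorem produce different ones.\<close>

definition avg_bound :: "(int \<Rightarrow> complex) \<Rightarrow> (nat \<Rightarrow> real) \<Rightarrow> bool" where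
  "avg_bound a R \<longleftrightarrow>
     (\<forall>i L n. 2 ^ n \<le> L \<longrightarrow> norm (\<Sum>l\<in>{i..<i + int L}. a l) \<le> real L * R n)"

lemma avg_boundD: "avg_bound a R \<Longrightarrow> 2 ^ n \<le> L \<Longrightarrow> norm (\<Sum>l\<in>{i..<i + int L}. a l) \<le> real L * R n"
  by (auto simp: avg_bound_def)

lemma avg_bound_nonneg:
  assumes "avg_bound a R"
  shows "0 \<le> R n"
proof -
  have "0 \<le> real (2 ^ n) * R n"
    using order_trans[OF norm_ge_zero avg_boundD[OF assms order_refl, of 0 n]] .
  moreover have "real (2 ^ n) * R n < 0" if "R n < 0"
    using that by (intro mult_pos_neg) auto
  ultimately show ?thesis by linarith
qed

lemma atilde_le:
  assumes "avg_bound a R"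
  shows "atilde a (2 ^ n) \<le> ereal (R n)"
  unfolding atilde_def
proof (rule SUP_least)
  fix w :: "int \<times> int"
  assume w: "w \<in> {(i, j). i \<le> j \<and> 2 ^ n \<le> nat (j - i + 1)}"
  obtain i j where wij: "w = (i, j)" by fastforce
  have ij: "i \<le> j" and L: "2 ^ n \<le> nat (j - i + 1)" using w wij by auto
  have "{i..j} = {i..<i + int (nat (j - i + 1))}" using ij by auto
  then have "norm (\<Sum>l\<in>{i..j}. a l) \<le> real (nat (j - i + 1)) * R n"
    using avg_boundD[OF assms L, of i] by simp
  then show "ereal (norm (\<Sum>l\<in>{fst w..snd w}. a l) / real_of_int (snd w - fst w + 1)) \<le> ereal (R n)"
    using ij wij by (simp add: field_simps)
qed

text \<open>A coefficient differs from the average over an adjacent interval by at most the variation; as long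
  averages vanish in the limit, the Riemann--Lebesgue lemma is not needed.\<close>

lemma norm_le_var_plus_avg:
  assumes s: "s = 1 \<or> s = (-1::int)" and R: "avg_bound a R"
    and var: "\<And>N. (\<Sum>j\<in>{m..<N}. norm (a (s * int j) - a (s * int (Suc j)))) \<le> B"
  shows "norm (a (s * int m)) \<le> B + R K"
proof -
  let ?L = "2 ^ K :: nat"
  \<comment> \<open>Left end of the window of \<open>2 ^ K\<close> indices that starts at
    \<open>s * m\<close> and runs away from the origin; for \<open>s = -1\<close> the point
    \<open>s * m\<close> is its right end.\<close>
  define i where "i = (if s = 1 then int m else - int m - int ?L + 1)"
  have "(\<lambda>j. s * int j) ` {m..<m+?L} = {i..<i + int ?L}"
  proof
    show "(\<lambda>j. s * int j) ` {m..<m+?L} \<subseteq> {i..<i + int ?L}"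
      using s unfolding i_def by (auto simp del: of_nat_power simp flip: of_nat_add)
    show "{i..<i + int ?L} \<subseteq> (\<lambda>j. s * int j) ` {m..<m+?L}"
    proof
      fix l assume l: "l \<in> {i..<i + int ?L}"
      then have "nat \<bar>l\<bar> \<in> {m..<m+?L}" "l = s * int (nat \<bar>l\<bar>)"
        using s unfolding i_def by (auto split: if_splits simp del: of_nat_power)
      then show "l \<in> (\<lambda>j. s * int j) ` {m..<m+?L}" by blast
    qed
  qed
  moreover have "inj_on (\<lambda>j. s * int j) {m..<m+?L}"
    using s by (auto simp: inj_on_def)
  ultimately have sum_eq: "(\<Sum>j\<in>{m..<m+?L}. a (s * int j)) = (\<Sum>l\<in>{i..<i + int ?L}. a l)"
    by (metis (no_types, lifting) sum.reindex_cong)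
  have avg: "norm (\<Sum>j\<in>{m..<m+?L}. a (s * int j)) \<le> 2 ^ K * R K"
    using avg_boundD[OF R order_refl, of i K] unfolding sum_eq by simp
  have tele: "norm (a (s * int m) - a (s * int (m + j))) \<le> B" for j
  proof -
    have "norm (a (s * int m) - a (s * int (m + j))) \<le> (\<Sum>i\<in>{m..<m+j}. norm (a (s * int i) - a (s * int (Suc i))))"
    proof (induction j)
      case (Suc j)
      have "norm (a (s * int m) - a (s * int (m + Suc j))) \<le>
         norm (a (s * int m) - a (s * int (m + j))) + norm (a (s * int (m + j)) - a (s * int (m + Suc j)))"
        by (rule norm_diff_triangle_ineq[of _ "a (s * int (m + j))" "a (s * int (m + j))", simplified, THEN order_trans]) simp
      then show ?case using Suc by simp
    qed simp
    then show ?thesis using var by (rule order_trans)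
  qed
  have "2 ^ K * a (s * int m) = (\<Sum>j\<in>{m..<m+?L}. a (s * int m))"
    by simp
  also have "\<dots> = (\<Sum>j\<in>{m..<m+?L}. a (s * int j)) + (\<Sum>j\<in>{m..<m+?L}. a (s * int m) - a (s * int j))"
    by (simp add: sum_subtractf)
  finally have "norm (2 ^ K * a (s * int m)) \<le> norm (\<Sum>j\<in>{m..<m+?L}. a (s * int j)) + norm (\<Sum>j\<in>{m..<m+?L}. a (s * int m) - a (s * int j))"
    by (simp only: norm_triangle_ineq)
  also have "norm (\<Sum>j\<in>{m..<m+?L}. a (s * int m) - a (s * int j)) \<le> (\<Sum>j\<in>{m..<m+?L}. B)"
  proof (rule sum_norm_le)
    fix j assume "j \<in> {m..<m+?L}"
    then show "norm (a (s * int m) - a (s * int j)) \<le> B" using tele[of "j - m"] by simp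
  qed
  finally have "2 ^ K * norm (a (s * int m)) \<le> 2 ^ K * (B + R K)"
    using avg by (simp add: norm_mult norm_power algebra_simps)
  then show ?thesis by simp
qed

text \<open>Each term under the supremum is at most the whole weighted kernel series, which
  converges by \<open>sR\<close>. Divided by the weight, this series is the real number
  \<open>U\<close> that bounds the supremum and ends the work in extended reals.\<close>

lemma GM_star_block_var:
  assumes p: "1 < p" and gm: "GM_star C a" and R: "avg_bound a R"
    and sR: "summable (\<lambda>n. (wt p n * R n) powr p)"
  shows "wt p n * block_var a n \<le> C * (\<Sum>k. kern (decay p) n k * (wt p k * R k))"
proof -
  have C: "0 < C" using gm by (simp add: GM_star_def)
  define U where "U = (\<Sum>k. kern (decay p) n k * (wt p k * R k)) / wt p n"
  have R0: "0 \<le> R k" for k by (rule avg_bound_nonneg[OF R])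
  have at: "atilde a (2 ^ k) \<le> ereal (R k)" for k
    by (rule atilde_le[OF R])
  have min_le: "min 1 (2 powr (real k - real n)) * R k \<le> U" for k
  proof -
    have "wt p n * min 1 (2 powr (real k - real n)) * R k \<le> kern (decay p) n k * wt p k * R k"
      by (intro mult_right_mono wt_kern_min p R0)
    also have "\<dots> \<le> (\<Sum>k. kern (decay p) n k * (wt p k * R k))"
      using sum_le_suminf[of "\<lambda>k. kern (decay p) n k * (wt p k * R k)" "{k}"] R0 p
        kern_mult_summable[OF decay_pos[OF p] _ _ sR, of n] by (simp add: mult.assoc)
    finally show ?thesis by (simp add: U_def field_simps)
  qed
  have "ereal (block_var a n) \<le> ereal C * (SUP k::nat. ereal (min 1 (2 powr (real k - real n))) * atilde a (2 ^ k))"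
    using gm by (simp add: GM_star_def block_var_def floor_half_power)
  also have "\<dots> \<le> ereal C * ereal U"
  proof (intro ereal_mult_left_mono SUP_least)
    fix k
    have "ereal (min 1 (2 powr (real k - real n))) * atilde a (2 ^ k)
        \<le> ereal (min 1 (2 powr (real k - real n))) * ereal (R k)"
      by (intro ereal_mult_left_mono at) auto
    also have "\<dots> \<le> ereal U" using min_le[of k] by (simp only: times_ereal.simps ereal_less_eq)
    finally show "ereal (min 1 (2 powr (real k - real n))) * atilde a (2 ^ k) \<le> ereal U" .
  qed (use C in auto)
  finally have "block_var a n \<le> C * U" by simp
  then show ?thesis by (simp add: U_def field_simps)
qed

text \<open>For \<open>j >= n\<close> the minimum in \<open>wt_kern_min\<close> equals 1, so the
  weighted tail is bounded by a part of a kernel row. The row \<open>n = 0\<close>, where the weight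
  is 1, yields the convergence of the tails themselves.\<close>

lemma block_var_tail:
  assumes p: "1 < p" and sV: "summable (\<lambda>n. (wt p n * block_var a n) powr p)"
  shows "summable (block_var a)"
    and "wt p n * (\<Sum>i. block_var a (i + n)) \<le> (\<Sum>j. kern (decay p) n j * (wt p j * block_var a j))"
proof -
  let ?v = "\<lambda>j. wt p j * block_var a j"
  have sk: "summable (\<lambda>j. kern (decay p) n j * ?v j)" for n
    using p by (intro kern_mult_summable[OF decay_pos _ _ sV]) (auto simp: block_var_nonneg)
  have le: "wt p n * block_var a (i + n) \<le> kern (decay p) n (i + n) * ?v (i + n)" for i n
  proof -
    have "min 1 (2 powr (real (i + n) - real n)) = 1"
      using ge_one_powr_ge_zero[of 2 "real i"] by simp
    then have "wt p n \<le> kern (decay p) n (i + n) * wt p (i + n)"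
      using wt_kern_min[OF p, of n "i + n"] by simp
    from mult_right_mono[OF this block_var_nonneg] show ?thesis
      by (simp add: mult.assoc)
  qed
  have 1: "block_var a i \<le> kern (decay p) 0 i * ?v i" for i
    using le[of 0 i] by (simp add: wt_def)
  show sb: "summable (block_var a)"
    by (rule summable_comparison_test'[OF sk[of 0]]) (use 1 block_var_nonneg in auto)
  have sn: "summable (\<lambda>i. kern (decay p) n (i + n) * ?v (i + n))"
    using sk[of n] by (rule summable_ignore_initial_segment)
  have "wt p n * (\<Sum>i. block_var a (i + n)) = (\<Sum>i. wt p n * block_var a (i + n))"
    using sb by (intro suminf_mult[symmetric]) (simp add: summable_iff_shift)
  also have "\<dots> \<le> (\<Sum>i. kern (decay p) n (i + n) * ?v (i + n))"
    using sb sn by (intro suminf_le le summable_mult) (simp_all add: summable_iff_shift)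
  also have "\<dots> \<le> (\<Sum>j. kern (decay p) n j * ?v j)"
    using suminf_split_initial_segment[OF sk[of n], of n]
      sum_nonneg[of "{..<n}" "\<lambda>j. kern (decay p) n j * ?v j"] by (simp add: block_var_nonneg)
  finally show "wt p n * (\<Sum>i. block_var a (i + n)) \<le> (\<Sum>j. kern (decay p) n j * ?v j)" .
qed

text \<open>Collects what both final estimates use. At \<open>n = 0\<close> the threshold is 0, so
  \<open>B 0\<close> bounds all coefficients and the whole variation on each half-line.\<close>

definition tail_majorant :: "(int \<Rightarrow> complex) \<Rightarrow> (nat \<Rightarrow> real) \<Rightarrow> bool" where
  "tail_majorant a B \<longleftrightarrow> (\<forall>n. B (Suc n) \<le> B n) \<and>
     (\<forall>k n. int (2 ^ n div 2) \<le> \<bar>k\<bar> \<longrightarrow> norm (a k) \<le> B n) \<and>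
     (\<forall>s\<in>{1, -1}. \<forall>n M N. 2 ^ n div 2 \<le> M \<longrightarrow>
        (\<Sum>j\<in>{M..<N}. norm (a (s * int j) - a (s * int (Suc j)))) \<le> B n)"

text \<open>Schur's test is applied twice, from averages to block variations at the cost of
  \<open>C\<close>, then from block variations to their tails; hence the constant
  \<open>K * (C powr p * K)\<close>. This is the one place where \<open>C\<close> enters the final
  constants.\<close>

lemma GM_star_tail_majorant:
  assumes p: "1 < p" and C: "0 < C"
  shows "\<exists>K>0. \<forall>a R. GM_star C a \<longrightarrow> avg_bound a R \<longrightarrow> summable (\<lambda>n. (wt p n * R n) powr p) \<longrightarrow>
      (\<exists>B. tail_majorant a B \<and> summable (\<lambda>n. (wt p n * B n) powr p) \<and>
        (\<Sum>n. (wt p n * B n) powr p) \<le> K * (\<Sum>n. (wt p n * R n) powr p))"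
proof -
  have d: "0 < decay p" and p0: "0 < p" using p by (auto intro: decay_pos)
  obtain K where K: "0 < K" and sch: "\<forall>b. (\<forall>m. 0 \<le> b m) \<longrightarrow> summable (\<lambda>m. b m powr p) \<longrightarrow>
       summable (\<lambda>n. (\<Sum>m. kern (decay p) n m * b m) powr p) \<and>
       (\<Sum>n. (\<Sum>m. kern (decay p) n m * b m) powr p) \<le> K * (\<Sum>m. b m powr p)"
    using kern_schur[OF d p0] by blast
  note schur = sch[rule_format]
  have main: "\<exists>B. tail_majorant a B \<and> summable (\<lambda>n. (wt p n * B n) powr p) \<and>
        (\<Sum>n. (wt p n * B n) powr p) \<le> (K * (C powr p * K)) * (\<Sum>n. (wt p n * R n) powr p)"
    if gm: "GM_star C a" and R: "avg_bound a R" and sR: "summable (\<lambda>n. (wt p n * R n) powr p)" for a R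
  proof -
    let ?V = "block_var a"
    define S where "S = (\<Sum>n. (wt p n * R n) powr p)"
    have R0: "0 \<le> wt p n * R n" for n using avg_bound_nonneg[OF R] by simp
    have "summable (\<lambda>n. (C * (wt p n * ?V n / C)) powr p) \<and>
       (\<Sum>n. (C * (wt p n * ?V n / C)) powr p) \<le> C powr p * (K * S)"
      using schur[OF R0 sR] GM_star_block_var[OF p gm R sR] C p0
      by (intro suminf_powr_le) (auto simp: S_def block_var_nonneg field_simps)
    then have sV: "summable (\<lambda>n. (wt p n * ?V n) powr p)"
      and leV: "(\<Sum>n. (wt p n * ?V n) powr p) \<le> C powr p * (K * S)"
      using C by auto
    define B where "B n = (\<Sum>i. ?V (i + n))" for n
    have sumV: "summable ?V" by (rule block_var_tail[OF p sV])
    have B0: "0 \<le> B n" for n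
      unfolding B_def using sumV by (intro suminf_nonneg) (auto simp: block_var_nonneg summable_iff_shift)
    have "summable (\<lambda>n. (1 * (wt p n * B n)) powr p) \<and>
       (\<Sum>n. (1 * (wt p n * B n)) powr p) \<le> 1 powr p * (K * (\<Sum>n. (wt p n * ?V n) powr p))"
    proof (rule suminf_powr_le[OF p0, where y = "\<lambda>n. \<Sum>j. kern (decay p) n j * (wt p j * ?V j)"])
      show "wt p n * B n \<le> (\<Sum>j. kern (decay p) n j * (wt p j * ?V j))" for n
        unfolding B_def by (rule block_var_tail(2)[OF p sV])
    qed (use schur[of "\<lambda>n. wt p n * ?V n"] sV B0 in \<open>auto simp: block_var_nonneg\<close>)
    then have sB: "summable (\<lambda>n. (wt p n * B n) powr p)"
      and leB: "(\<Sum>n. (wt p n * B n) powr p) \<le> K * (C powr p * (K * S))"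
      using order_trans[OF _ mult_left_mono[OF leV less_imp_le[OF K]]] by auto
    have decB: "B (Suc n) \<le> B n" for n
      using suminf_split_head[of "\<lambda>i. ?V (i + n)"] sumV block_var_nonneg[of a n]
      by (simp add: B_def summable_iff_shift)
    have varB: "(\<Sum>j\<in>{M..<N}. norm (a (s * int j) - a (s * int (Suc j)))) \<le> B n"
      if "s = 1 \<or> s = -1" "2 ^ n div 2 \<le> M" for s n M N
      unfolding B_def by (rule side_var_le[OF that(1) sumV that(2)])
    \<comment> \<open>The bound \<open>B n + R k\<close> holds for every \<open>k\<close>, and
      \<open>R k\<close> tends to 0 because the weights are at least 1 and the weighted p-th powers
      are summable. A positive excess \<open>e\<close> would keep those powers away from 0.\<close>
    have normB: "norm (a (s * int m)) \<le> B n" if s: "s = 1 \<or> s = -1" and m: "2 ^ n div 2 \<le> m" for s n m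
    proof (rule ccontr)
      assume neg: "\<not> norm (a (s * int m)) \<le> B n"
      define e where "e = norm (a (s * int m)) - B n"
      have e: "0 < e" using neg by (simp add: e_def)
      have "e powr p \<le> (wt p k * R k) powr p" for k
      proof -
        have "e \<le> R k"
          using norm_le_var_plus_avg[OF s R, of m "B n" k] varB[OF s m] by (simp add: e_def)
        also have "\<dots> \<le> wt p k * R k"
          using wt_ge_1[OF p, of k] avg_bound_nonneg[OF R, of k] by (simp add: mult_left_le_one_le mult_right_mono[of 1 "wt p k" "R k", simplified])
        finally show ?thesis using e p by (intro powr_mono2) auto
      qed
      then have "e powr p \<le> 0"
        by (intro LIMSEQ_le_const[OF summable_LIMSEQ_zero[OF sR]]) auto
      then show False using e by simp
    qed
    have "tail_majorant a B"
      unfolding tail_majorant_def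
    proof (intro conjI allI impI ballI)
      fix k :: int and n assume k: "int (2 ^ n div 2) \<le> \<bar>k\<bar>"
      have "k = (if 0 \<le> k then 1 else -1) * int (nat \<bar>k\<bar>)" by simp
      moreover have "norm (a ((if 0 \<le> k then 1 else -1) * int (nat \<bar>k\<bar>))) \<le> B n"
        using k by (intro normB) (auto simp: le_nat_iff)
      ultimately show "norm (a k) \<le> B n" by metis
    qed (use decB varB in auto)
    then show ?thesis using sB leB by (auto simp: S_def mult.assoc)
  qed
  show ?thesis
    by (rule exI[of _ "K * (C powr p * K)"]) (use K C main in auto)
qed

section \<open>Condensation and the decreasing rearrangement\<close>

lemma sum_dyadic_shift:
  fixes g :: "nat \<Rightarrow> 'a::comm_monoid_add"
  shows "(\<Sum>k<2 ^ N - 1. g k) = (\<Sum>n<N. \<Sum>k\<in>{2 ^ n - 1..<2 ^ Suc n - 1}. g k)"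
proof (induction N)
  case (Suc N)
  have "2 ^ N - 1 \<le> (2::nat) ^ Suc N - 1" by (intro diff_le_mono power_increasing) auto
  then have "(\<Sum>k<2 ^ Suc N - 1. g k) = (\<Sum>k<2 ^ N - 1. g k) + (\<Sum>k\<in>{2 ^ N - 1..<2 ^ Suc N - 1}. g k)"
    unfolding lessThan_atLeast0 by (intro sum.atLeastLessThan_concat[symmetric]) auto
  then show ?case using Suc by simp
qed simp

lemma sum_dyadic:
  fixes g :: "nat \<Rightarrow> 'a::comm_monoid_add"
  shows "(\<Sum>k<2 ^ N. g k) = g 0 + (\<Sum>n<N. \<Sum>k\<in>{2 ^ n..<2 ^ Suc n}. g k)"
proof (induction N)
  case (Suc N)
  have "(\<Sum>k<2 ^ Suc N. g k) = (\<Sum>k<2 ^ N. g k) + (\<Sum>k\<in>{2 ^ N..<2 ^ Suc N}. g k)"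
    unfolding lessThan_atLeast0 by (intro sum.atLeastLessThan_concat[symmetric]) auto
  then show ?case using Suc by (simp add: add.assoc)
qed simp

text \<open>The exponent \<open>p - 2\<close> may have either sign, so powers of numbers within a
  factor 2 are compared in both directions, at the cost \<open>2 powr \<bar>s\<bar>\<close>.\<close>

lemma powr_between_le:
  fixes x y s :: real
  assumes "0 < x" "x \<le> y" "y \<le> 2 * x"
  shows "x powr s \<le> 2 powr \<bar>s\<bar> * y powr s" "y powr s \<le> 2 powr \<bar>s\<bar> * x powr s"
proof -
  have r: "1 \<le> y / x" "y / x \<le> 2" using assms by (auto simp: field_simps)
  have *: "(y / x) powr t \<le> 2 powr \<bar>s\<bar>" if "t \<le> \<bar>s\<bar>" for t
  proof -
    have "(y / x) powr t \<le> (y / x) powr \<bar>s\<bar>" using r that by (intro powr_mono) auto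
    also have "\<dots> \<le> 2 powr \<bar>s\<bar>" using r by (intro powr_mono2) auto
    finally show ?thesis .
  qed
  show "x powr s \<le> 2 powr \<bar>s\<bar> * y powr s"
    using *[of "- s"] assms by (simp add: powr_divide powr_minus field_simps)
  show "y powr s \<le> 2 powr \<bar>s\<bar> * x powr s"
    using *[of s] assms by (simp add: powr_divide powr_minus field_simps)
qed

text \<open>The blocks are dyadic in \<open>k + 1\<close>, which is why the values of \<open>d\<close> are taken at \<open>2\<^sup>n - 1\<close>.\<close>

lemma condensation_upper:
  fixes p :: real
  assumes p: "1 < p" and dec: "antimono d" and d0: "\<And>n. (0::real) \<le> d n"
    and s: "summable (\<lambda>n. (wt p n * d (2 ^ n - 1)) powr p)"
  shows "summable (\<lambda>k. (real k + 1) powr (p - 2) * d k powr p)"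
    and "(\<Sum>k. (real k + 1) powr (p - 2) * d k powr p)
      \<le> 2 powr \<bar>p - 2\<bar> * (\<Sum>n. (wt p n * d (2 ^ n - 1)) powr p)"
proof -
  let ?g = "\<lambda>k. (real k + 1) powr (p - 2) * d k powr p"
  let ?c = "2 powr \<bar>p - 2\<bar>"
  have block: "(\<Sum>k\<in>{2 ^ n - 1..<2 ^ Suc n - 1}. ?g k) \<le> ?c * (wt p n * d (2 ^ n - 1)) powr p" for n
  proof -
    have "(\<Sum>k\<in>{2 ^ n - 1..<2 ^ Suc n - 1}. ?g k)
        \<le> (\<Sum>k\<in>{2 ^ n - 1..<2 ^ Suc n - 1::nat}. (?c * (2 ^ n) powr (p - 2)) * d (2 ^ n - 1) powr p)"
    proof (rule sum_mono, rule mult_mono)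
      fix k :: nat assume k: "k \<in> {2 ^ n - 1..<2 ^ Suc n - 1}"
      then have "2 ^ n \<le> Suc k" "Suc k \<le> 2 * 2 ^ n" by auto
      then have "real (2 ^ n) \<le> real (Suc k)" "real (Suc k) \<le> real (2 * 2 ^ n)"
        by (simp_all only: of_nat_le_iff)
      then show "(real k + 1) powr (p - 2) \<le> ?c * (2 ^ n) powr (p - 2)"
        by (intro powr_between_le) auto
      show "d k powr p \<le> d (2 ^ n - 1) powr p"
        using k p d0 by (intro powr_mono2 antimonoD[OF dec]) auto
    qed auto
    also have "\<dots> = real (card {2 ^ n - 1..<2 ^ Suc n - 1::nat}) * ((?c * (2 ^ n) powr (p - 2)) * d (2 ^ n - 1) powr p)"
      by simp
    also have "card {2 ^ n - 1..<2 ^ Suc n - 1::nat} = 2 ^ n"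
      by simp
    also have "real (2 ^ n) * ((?c * (2 ^ n) powr (p - 2)) * d (2 ^ n - 1) powr p) = ?c * (wt p n * d (2 ^ n - 1)) powr p"
    proof -
      have "real (2 ^ n) * (2 ^ n) powr (p - 2) = wt p n powr p"
        using p by (simp add: wt_powr powr_realpow[symmetric] powr_powr algebra_simps flip: powr_add)
      then show ?thesis by (simp add: powr_mult algebra_simps)
    qed
    finally show ?thesis .
  qed
  have part: "(\<Sum>k<N. ?g k) \<le> ?c * (\<Sum>n. (wt p n * d (2 ^ n - 1)) powr p)" for N
  proof -
    have "N \<le> 2 ^ N - 1" using less_exp[of N] by linarith
    then have "(\<Sum>k<N. ?g k) \<le> (\<Sum>k<2 ^ N - 1. ?g k)"
      by (intro sum_mono2) auto
    also have "\<dots> \<le> (\<Sum>n<N. ?c * (wt p n * d (2 ^ n - 1)) powr p)"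
      unfolding sum_dyadic_shift by (intro sum_mono block)
    also have "\<dots> \<le> ?c * (\<Sum>n. (wt p n * d (2 ^ n - 1)) powr p)"
      unfolding sum_distrib_left[symmetric] using s by (intro mult_left_mono sum_le_suminf) auto
    finally show ?thesis .
  qed
  show sg: "summable ?g"
    by (rule summableI_nonneg_bounded[OF _ part]) simp
  show "suminf ?g \<le> ?c * (\<Sum>n. (wt p n * d (2 ^ n - 1)) powr p)"
    by (rule suminf_le_const[OF sg part])
qed

text \<open>Here the blocks are dyadic in \<open>k\<close>: the sampled index
  \<open>2 ^ Suc n - 1\<close> is the last one of \<open>{2 ^ n..<2 ^ Suc n}\<close>, so its value
  is the smallest there. The extra factor 2 pays for setting the weight of level n + 1 against a
  block of only \<open>2 ^ n\<close> indices; level 0 is the term of index 0 itself.\<close>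

lemma condensation_lower:
  fixes p :: real
  assumes p: "1 < p" and dec: "antimono d" and d0: "\<And>n. (0::real) \<le> d n"
    and s: "summable (\<lambda>k. (real k + 1) powr (p - 2) * d k powr p)"
  shows "summable (\<lambda>n. (wt p n * d (2 ^ n - 1)) powr p)"
    and "(\<Sum>n. (wt p n * d (2 ^ n - 1)) powr p)
      \<le> 2 * 2 powr \<bar>p - 2\<bar> * (\<Sum>k. (real k + 1) powr (p - 2) * d k powr p)"
proof -
  let ?g = "\<lambda>k. (real k + 1) powr (p - 2) * d k powr p"
  let ?c = "2 * 2 powr \<bar>p - 2\<bar> :: real"
  have c: "1 \<le> ?c" using ge_one_powr_ge_zero[of 2 "\<bar>p - 2\<bar>"] by simp
  have block: "(wt p (Suc n) * d (2 ^ Suc n - 1)) powr p \<le> ?c * (\<Sum>k\<in>{2 ^ n..<2 ^ Suc n}. ?g k)" for n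
  proof -
    let ?N = "2 ^ Suc n :: real"
    have "(wt p (Suc n) * d (2 ^ Suc n - 1)) powr p = 2 * (real (2 ^ n) * (?N powr (p - 2) * d (2 ^ Suc n - 1) powr p))"
    proof -
      have "?N * ?N powr (p - 2) = wt p (Suc n) powr p"
        using p by (simp add: wt_powr powr_realpow[symmetric] powr_powr algebra_simps flip: powr_add del: power_Suc)
      then show ?thesis by (simp add: powr_mult algebra_simps)
    qed
    also have "real (2 ^ n) * (?N powr (p - 2) * d (2 ^ Suc n - 1) powr p)
      = (\<Sum>k\<in>{2 ^ n..<2 ^ Suc n::nat}. ?N powr (p - 2) * d (2 ^ Suc n - 1) powr p)"
      by simp
    also have "\<dots> \<le> (\<Sum>k\<in>{2 ^ n..<2 ^ Suc n}. (2 powr \<bar>p - 2\<bar> * (real k + 1) powr (p - 2)) * d k powr p)"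
    proof (rule sum_mono, rule mult_mono)
      fix k :: nat assume k: "k \<in> {2 ^ n..<2 ^ Suc n}"
      then have "Suc k \<le> 2 ^ Suc n" "2 ^ Suc n \<le> 2 * Suc k" by auto
      then have "real (Suc k) \<le> real (2 ^ Suc n)" "real (2 ^ Suc n) \<le> real (2 * Suc k)"
        by (simp_all only: of_nat_le_iff)
      then show "?N powr (p - 2) \<le> 2 powr \<bar>p - 2\<bar> * (real k + 1) powr (p - 2)"
        by (intro powr_between_le) (auto simp del: power_Suc)
      show "d (2 ^ Suc n - 1) powr p \<le> d k powr p"
        using k p d0 by (intro powr_mono2 antimonoD[OF dec]) auto
    qed auto
    finally show ?thesis by (simp add: sum_distrib_left mult.assoc)
  qed
  have part: "(\<Sum>n<N. (wt p n * d (2 ^ n - 1)) powr p) \<le> ?c * suminf ?g" for N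
  proof (cases N)
    case 0
    then show ?thesis using s by (simp add: suminf_nonneg)
  next
    case (Suc M)
    have "(\<Sum>n<N. (wt p n * d (2 ^ n - 1)) powr p) = d 0 powr p + (\<Sum>n<M. (wt p (Suc n) * d (2 ^ Suc n - 1)) powr p)"
      unfolding Suc sum.lessThan_Suc_shift by (simp add: wt_def)
    also have "\<dots> \<le> ?c * ?g 0 + (\<Sum>n<M. ?c * (\<Sum>k\<in>{2 ^ n..<2 ^ Suc n}. ?g k))"
      using mult_right_mono[OF c, of "d 0 powr p"] by (intro add_mono sum_mono block) simp
    also have "\<dots> = ?c * (\<Sum>k<2 ^ M. ?g k)"
      unfolding sum_dyadic by (simp add: distrib_left sum_distrib_left)
    also have "\<dots> \<le> ?c * suminf ?g"
      using s by (intro mult_left_mono sum_le_suminf) auto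
    finally show ?thesis .
  qed
  show sg: "summable (\<lambda>n. (wt p n * d (2 ^ n - 1)) powr p)"
    by (rule summableI_nonneg_bounded[OF _ part]) simp
  show "(\<Sum>n. (wt p n * d (2 ^ n - 1)) powr p) \<le> ?c * suminf ?g"
    by (rule suminf_le_const[OF sg part])
qed

lemma dyadic_sum_le:
  fixes d :: "nat \<Rightarrow> real"
  assumes dec: "antimono d" and d0: "\<And>n. 0 \<le> d n"
  shows "(\<Sum>k<2 ^ n. d k) \<le> (\<Sum>i\<le>n. 2 ^ i * d (2 ^ i - 1))"
proof -
  \<comment> \<open>The shifted blocks below level \<open>n\<close> cover only
    \<open>2 ^ n - 1\<close> indices; the last index is the first of block \<open>n\<close> and is
    charged to the term \<open>i = n\<close>.\<close>
  have "(\<Sum>k<2 ^ n. d k) = (\<Sum>k<Suc (2 ^ n - 1). d k)"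
    by simp
  also have "\<dots> = (\<Sum>i<n. \<Sum>k\<in>{2 ^ i - 1..<2 ^ Suc i - 1}. d k) + d (2 ^ n - 1)"
    by (simp only: sum.lessThan_Suc sum_dyadic_shift)
  also have "\<dots> \<le> (\<Sum>i<n. 2 ^ i * d (2 ^ i - 1)) + 2 ^ n * d (2 ^ n - 1)"
  proof (intro add_mono sum_mono)
    fix i
    have "(\<Sum>k\<in>{2 ^ i - 1..<2 ^ Suc i - 1}. d k) \<le> (\<Sum>k\<in>{2 ^ i - 1..<2 ^ Suc i - 1::nat}. d (2 ^ i - 1))"
      by (intro sum_mono antimonoD[OF dec]) auto
    then show "(\<Sum>k\<in>{2 ^ i - 1..<2 ^ Suc i - 1}. d k) \<le> 2 ^ i * d (2 ^ i - 1)" by simp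
    show "d (2 ^ n - 1) \<le> 2 ^ n * d (2 ^ n - 1)"
      using mult_right_mono[OF one_le_power[of "2::real" n] d0[of "2 ^ n - 1"]] by simp
  qed
  finally show ?thesis by (simp add: lessThan_Suc_atMost[symmetric])
qed

text \<open>A Hardy average on the dyadic scale. Only \<open>i <= n\<close> occurs, where the
  minimum in \<open>wt_kern_min\<close> is \<open>2 powr (real i - real n)\<close>: the half of the
  kernel complementary to that in \<open>block_var_tail\<close>.\<close>

lemma dyadic_average_kern:
  assumes p: "1 < p" and u0: "\<And>i. (0::real) \<le> u i" and s: "summable (\<lambda>i. (wt p i * u i) powr p)"
  shows "wt p n * ((\<Sum>i\<le>n. 2 ^ i * u i) / 2 ^ n) \<le> (\<Sum>i. kern (decay p) n i * (wt p i * u i))"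
proof -
  have "wt p n * ((\<Sum>i\<le>n. 2 ^ i * u i) / 2 ^ n) = (\<Sum>i\<le>n. wt p n * 2 powr (real i - real n) * u i)"
    by (simp add: sum_divide_distrib sum_distrib_left powr_diff powr_realpow algebra_simps)
  also have "\<dots> \<le> (\<Sum>i\<le>n. kern (decay p) n i * (wt p i * u i))"
  proof (rule sum_mono)
    fix i assume "i \<in> {..n}"
    then have "min 1 (2 powr (real i - real n)) = 2 powr (real i - real n)"
      using powr_mono[of "real i - real n" 0 2] by simp
    then show "wt p n * 2 powr (real i - real n) * u i \<le> kern (decay p) n i * (wt p i * u i)"
      using mult_right_mono[OF wt_kern_min[OF p, of n i] u0[of i]] by (simp add: mult.assoc)
  qed
  also have "\<dots> \<le> (\<Sum>i. kern (decay p) n i * (wt p i * u i))"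
    using p u0 by (intro sum_le_suminf kern_mult_summable[OF decay_pos _ _ s]) auto
  finally show ?thesis .
qed

text \<open>\<open>decr_rearr\<close> is an infimum of reals and is meaningful only over a nonempty
  set. A bound on the sequence supplies a member, which is why \<open>M\<close> accompanies the
  lower bounds and the monotonicity below.\<close>

lemma bound_mem_decr_rearr_set:
  assumes "\<And>k. norm (a k) \<le> M"
  shows "M \<in> {t::real. 0 \<le> t \<and> finite {k::int. norm (a k) > t} \<and> card {k::int. norm (a k) > t} \<le> n}"
proof -
  have "{k. norm (a k) > M} = {}" using assms by (auto simp: not_less)
  moreover have "0 \<le> M" using order_trans[OF norm_ge_zero assms] .
  ultimately show ?thesis by simp
qed

lemma decr_rearr_nonneg:
  assumes "\<And>k. norm (a k) \<le> M"
  shows "0 \<le> decr_rearr a n"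
  unfolding decr_rearr_def using bound_mem_decr_rearr_set[of a M n, OF assms] by (intro cInf_greatest) auto

lemma decr_rearr_le:
  assumes "0 \<le> t" "finite {k. norm (a k) > t}" "card {k. norm (a k) > t} \<le> n"
  shows "decr_rearr a n \<le> t"
  unfolding decr_rearr_def using assms by (intro cInf_lower) (auto intro: bdd_belowI[of _ 0])

lemma decr_rearr_antimono:
  assumes "\<And>k. norm (a k) \<le> M"
  shows "antimono (decr_rearr a)"
proof (rule antimonoI)
  fix m n :: nat assume "m \<le> n"
  then show "decr_rearr a n \<le> decr_rearr a m"
    unfolding decr_rearr_def using bound_mem_decr_rearr_set[of a M m, OF assms]
    by (intro cInf_superset_mono) (auto intro: bdd_belowI[of _ 0])
qed

text \<open>Remove an element \<open>k\<close> of least modulus. If \<open>S\<close> has n + 1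
  elements and at most n moduli exceed \<open>t\<close>, some modulus in \<open>S\<close> is at most
  \<open>t\<close>, hence so is the least one; taking the infimum over \<open>t\<close> bounds it by
  \<open>decr_rearr a n\<close>.\<close>

lemma sum_le_decr_rearr:
  assumes bd: "\<And>k. norm (a k) \<le> M" and "finite S"
  shows "(\<Sum>k\<in>S. norm (a k)) \<le> (\<Sum>i<card S. decr_rearr a i)"
  using \<open>finite S\<close>
proof (induction "card S" arbitrary: S)
  case (Suc n)
  have ne: "S \<noteq> {}" using Suc.hyps(2) by auto
  define k where "k = arg_min_on (\<lambda>k. norm (a k)) S"
  have k: "k \<in> S" unfolding k_def using ne Suc.prems by (rule arg_min_if_finite[rotated])
  have kmin: "norm (a k) \<le> norm (a j)" if "j \<in> S" for j
    unfolding k_def using Suc.prems ne that by (rule arg_min_least)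
  have "norm (a k) \<le> decr_rearr a n"
    unfolding decr_rearr_def
  proof (rule cInf_greatest)
    show "{t. 0 \<le> t \<and> finite {k. norm (a k) > t} \<and> card {k. norm (a k) > t} \<le> n} \<noteq> {}"
      using bound_mem_decr_rearr_set[of a M n, OF bd] by blast
    fix t assume t: "t \<in> {t. 0 \<le> t \<and> finite {k. norm (a k) > t} \<and> card {k. norm (a k) > t} \<le> n}"
    have "\<not> S \<subseteq> {k. norm (a k) > t}"
      using t Suc.hyps(2) card_mono[of "{k. norm (a k) > t}" S] by auto
    then obtain j where "j \<in> S" "norm (a j) \<le> t" by force
    then show "norm (a k) \<le> t" using kmin by force
  qed
  moreover have "(\<Sum>j\<in>S - {k}. norm (a j)) \<le> (\<Sum>i<card (S - {k}). decr_rearr a i)"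
    using Suc.hyps k Suc.prems by (intro Suc.hyps(1)) auto
  moreover have "card (S - {k}) = n" using Suc.hyps k Suc.prems by simp
  moreover have "(\<Sum>j\<in>S. norm (a j)) = norm (a k) + (\<Sum>j\<in>S - {k}. norm (a j))"
    using Suc.prems k by (rule sum.remove)
  ultimately show ?case using Suc.hyps(2)[symmetric] by simp
qed simp

text \<open>Lets an interval of any length \<open>L >= 2 ^ n\<close> be measured by the dyadic
  average of level \<open>n\<close>. The induction works because the new term \<open>d L\<close> is
  at most each of the first \<open>K\<close> terms.\<close>

lemma sum_antimono_le:
  fixes d :: "nat \<Rightarrow> real"
  assumes dec: "antimono d" and KL: "K \<le> L"
  shows "real K * (\<Sum>i<L. d i) \<le> real L * (\<Sum>i<K. d i)"
  using KL
proof (induction L rule: dec_induct)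
  case (step L)
  have "real K * d L = (\<Sum>i<K. d L)" by simp
  also have "\<dots> \<le> (\<Sum>i<K. d i)"
    using step by (intro sum_mono antimonoD[OF dec]) auto
  finally show ?case using step by (simp add: algebra_simps)
qed simp

text \<open>The part of the symmetric rearrangement placed at the indices \<open>k \<ge> 0\<close>.\<close>

definition even_rearr :: "(int \<Rightarrow> complex) \<Rightarrow> nat \<Rightarrow> real" where
  "even_rearr a n = decr_rearr a (2 * n)"

text \<open>Interval sums are at most sums of the largest values, and the ranks 2m and 2m + 1 are
  both charged to rank 2m. This pairing is the source of the factor 2 and lets the half
  \<open>k >= 0\<close> of the symmetric rearrangement control all averages.\<close>

lemma avg_bound_rearr:
  assumes bd: "\<And>k. norm (a k) \<le> M"
  shows "avg_bound a (\<lambda>n. 2 * ((\<Sum>i\<le>n. 2 ^ i * even_rearr a (2 ^ i - 1)) / 2 ^ n))"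
  unfolding avg_bound_def
proof (intro allI impI)
  fix i :: int and L n :: nat assume L: "2 ^ n \<le> L"
  note dec = decr_rearr_antimono[of a M, OF bd]
  note d0 = decr_rearr_nonneg[of a M, OF bd]
  let ?d = "decr_rearr a"
  have "norm (\<Sum>l\<in>{i..<i + int L}. a l) \<le> (\<Sum>l\<in>{i..<i + int L}. norm (a l))"
    by (rule norm_sum)
  also have "\<dots> \<le> (\<Sum>i<L. ?d i)"
    using sum_le_decr_rearr[of a M "{i..<i + int L}", OF bd] by simp
  finally have 1: "2 ^ n * norm (\<Sum>l\<in>{i..<i + int L}. a l) \<le> real L * (\<Sum>i<2 ^ n. ?d i)"
    using sum_antimono_le[OF dec L] by (simp add: order_trans[OF mult_left_mono])
  \<comment> \<open>The range is doubled so that it consists of \<open>2 ^ n\<close> full pairs,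
    also when \<open>n = 0\<close>.\<close>
  have "(\<Sum>i<2 ^ n. ?d i) \<le> (\<Sum>i<2 ^ n * 2. ?d i)"
    using d0 by (intro sum_mono2) auto
  also have "\<dots> = (\<Sum>m<2 ^ n. \<Sum>i\<in>{m * 2..<m * 2 + 2}. ?d i)"
    by (rule sum.nat_group[symmetric])
  also have "\<dots> \<le> (\<Sum>m<2 ^ n. 2 * even_rearr a m)"
  proof (rule sum_mono)
    fix m
    have "(\<Sum>i\<in>{m * 2..<m * 2 + 2}. ?d i) \<le> (\<Sum>i\<in>{m * 2..<m * 2 + 2}. ?d (2 * m))"
      by (intro sum_mono antimonoD[OF dec]) auto
    then show "(\<Sum>i\<in>{m * 2..<m * 2 + 2}. ?d i) \<le> 2 * even_rearr a m"
      by (simp add: even_rearr_def)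
  qed
  also have "\<dots> \<le> 2 * (\<Sum>i\<le>n. 2 ^ i * even_rearr a (2 ^ i - 1))"
    unfolding sum_distrib_left[symmetric] using d0
    by (intro mult_left_mono dyadic_sum_le antimonoI) (auto simp: even_rearr_def intro: antimonoD[OF dec])
  finally have "real L * (\<Sum>i<2 ^ n. ?d i) \<le> real L * (2 * (\<Sum>i\<le>n. 2 ^ i * even_rearr a (2 ^ i - 1)))"
    by (rule mult_left_mono) simp
  with 1 show "norm (\<Sum>l\<in>{i..<i + int L}. a l) \<le> real L * (2 * ((\<Sum>i\<le>n. 2 ^ i * even_rearr a (2 ^ i - 1)) / 2 ^ n))"
    by (simp add: field_simps)
qed

text \<open>Moduli above \<open>B n\<close> occur only for
  \<open>\<bar>k\<bar> < 2 ^ n div 2\<close>, that is at no more than \<open>2 ^ n - 1\<close>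
  places (none when \<open>n = 0\<close>), which is exactly the rank sampled by the
  condensation.\<close>

lemma decr_rearr_tail_majorant:
  assumes B: "tail_majorant a B"
  shows "decr_rearr a (2 ^ n - 1) \<le> B n"
proof -
  have le: "norm (a k) \<le> B n" if "int (2 ^ n div 2) \<le> \<bar>k\<bar>" for k
    using B that by (auto simp: tail_majorant_def)
  let ?m = "int (2 ^ n div 2)"
  have sub: "{k. norm (a k) > B n} \<subseteq> {- ?m<..<?m}"
  proof
    fix k assume "k \<in> {k. norm (a k) > B n}"
    then have "\<not> ?m \<le> \<bar>k\<bar>" using le[of k] by auto
    then show "k \<in> {- ?m<..<?m}" by auto
  qed
  show ?thesis
  proof (rule decr_rearr_le)
    show "0 \<le> B n" using le[of ?m] by (rule order_trans[OF norm_ge_zero]) simp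
    show "finite {k. norm (a k) > B n}" using sub by (rule finite_subset) simp
    have "card {k. norm (a k) > B n} \<le> card {- ?m<..<?m}"
      by (rule card_mono[OF _ sub]) simp
    also have "\<dots> \<le> 2 ^ n - 1"
      by (cases n) (auto simp: nat_le_iff of_nat_diff)
    finally show "card {k. norm (a k) > B n} \<le> 2 ^ n - 1" .
  qed
qed

section \<open>Dyadic shells\<close>

definition shell :: "nat \<Rightarrow> real set" where
  "shell n = {x. pi / 2 ^ Suc n < \<bar>x\<bar> \<and> \<bar>x\<bar> \<le> pi / 2 ^ n}"

lemma shell_borel [measurable]: "shell n \<in> sets borel"
  unfolding shell_def by measurable

lemma shell_eq: "shell n = {- (pi / 2 ^ n)..< - (pi / 2 ^ Suc n)} \<union> {pi / 2 ^ Suc n<..pi / 2 ^ n}"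
proof -
  have "0 < pi / 2 ^ Suc n" by simp
  then show ?thesis unfolding shell_def by (auto simp: abs_if)
qed

lemma emeasure_shell: "emeasure lborel (shell n) = ennreal (pi / 2 ^ n)"
proof -
  have "0 < pi / 2 ^ Suc n" by simp
  then have "emeasure lborel (shell n) = emeasure lborel {- (pi / 2 ^ n)..< - (pi / 2 ^ Suc n)}
      + emeasure lborel {pi / 2 ^ Suc n<..pi / 2 ^ n}"
    unfolding shell_eq by (intro plus_emeasure[symmetric]) auto
  also have "\<dots> = ennreal (pi / 2 ^ n)"
    by (simp add: field_simps flip: ennreal_plus)
  finally show ?thesis .
qed

lemma shell_disjoint: "m \<noteq> n \<Longrightarrow> shell m \<inter> shell n = {}"
proof (induction m n rule: linorder_wlog)
  case (le m n)
  then have "pi / 2 ^ n \<le> pi / 2 ^ Suc m"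
    by (intro divide_left_mono power_increasing) auto
  then show ?case by (auto simp: shell_def)
qed auto

lemma shell_Union: "(\<Union>n. shell n) = {-pi..pi} - {0}"
proof
  show "(\<Union>n. shell n) \<subseteq> {-pi..pi} - {0}"
  proof
    fix x assume "x \<in> (\<Union>n. shell n)"
    then obtain n where n: "pi / 2 ^ Suc n < \<bar>x\<bar>" "\<bar>x\<bar> \<le> pi / 2 ^ n" by (auto simp: shell_def)
    have "pi / 2 ^ n \<le> pi / 1" by (intro divide_left_mono) auto
    moreover have "0 < pi / 2 ^ Suc n" by simp
    ultimately have "0 < \<bar>x\<bar>" "\<bar>x\<bar> \<le> pi" using n by (auto intro: less_trans)
    then show "x \<in> {-pi..pi} - {0}" by auto
  qed
  show "{-pi..pi} - {0} \<subseteq> (\<Union>n. shell n)"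
  proof
    fix x :: real assume x: "x \<in> {-pi..pi} - {0}"
    have x0: "0 < \<bar>x\<bar>" using x by simp
    have "(1::real) < 2" by simp
    from real_arch_pow[OF this, of "pi / \<bar>x\<bar>"] obtain k where "pi / \<bar>x\<bar> < 2 ^ k" ..
    then have "pi < 2 ^ k * \<bar>x\<bar>"
      by (simp only: pos_divide_less_eq[OF x0])
    then have "pi / 2 ^ k < \<bar>x\<bar>"
      by (simp add: pos_divide_less_eq mult.commute)
    moreover have "pi / 2 ^ Suc k \<le> pi / 2 ^ k"
      by (intro divide_left_mono power_increasing) auto
    ultimately have ex: "\<exists>k. pi / 2 ^ Suc k < \<bar>x\<bar>"
      using order_le_less_trans by blast
    define n where "n = (LEAST k. pi / 2 ^ Suc k < \<bar>x\<bar>)"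
    have 1: "pi / 2 ^ Suc n < \<bar>x\<bar>" unfolding n_def using ex by (rule LeastI_ex)
    have 2: "\<bar>x\<bar> \<le> pi / 2 ^ n"
    proof (cases n)
      case 0 then show ?thesis using x by auto
    next
      case (Suc m)
      then have "\<not> pi / 2 ^ Suc m < \<bar>x\<bar>" unfolding n_def by (intro not_less_Least) auto
      then show ?thesis using Suc by simp
    qed
    show "x \<in> (\<Union>n. shell n)" using 1 2 by (auto simp: shell_def)
  qed
qed

lemma shell_subset: "shell n \<subseteq> {-pi..pi}"
  using shell_Union by blast

section \<open>Lower bound for \<open>norm (1 - cis x)\<close> on a shell\<close>

lemma jordan_sin:
  assumes "0 \<le> x" "x \<le> pi / 2"
  shows "2 * x / pi \<le> sin x"
proof -
  have "concave_on {0..pi} sin"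
  proof (rule f''_le0_imp_concave)
    show "(sin has_real_derivative cos x) (at x)" for x :: real by (rule DERIV_sin)
    show "(cos has_real_derivative - sin x) (at x)" for x :: real by (rule DERIV_cos)
  qed (auto simp: sin_ge_zero)
  then have "(1 - 2 * x / pi) * sin 0 + (2 * x / pi) * sin (pi / 2) \<le> sin ((1 - 2 * x / pi) *\<^sub>R 0 + (2 * x / pi) *\<^sub>R (pi / 2))"
    using assms by (intro concave_onD) (auto simp: field_simps)
  then show ?thesis by simp
qed

lemma norm_one_minus_cis: 
  assumes "\<bar>x\<bar> \<le> pi"
  shows "2 * \<bar>x\<bar> / pi \<le> norm (1 - cis x)"
proof -
  have "norm (1 - cis x) ^ 2 = (1 - cos x)^2 + (sin x)^2"
    by (simp add: cmod_power2)
  also have "\<dots> = 2 - 2 * cos x"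
    using sin_cos_squared_add[of x] by (simp add: power2_eq_square algebra_simps)
  also have "\<dots> = (2 * sin (\<bar>x\<bar> / 2)) ^ 2"
    using cos_double_sin[of "\<bar>x\<bar> / 2"] by (simp add: power_mult_distrib)
  finally have "sqrt ((norm (1 - cis x))\<^sup>2) = sqrt ((2 * sin (\<bar>x\<bar> / 2))\<^sup>2)"
    by (simp only:)
  then have "norm (1 - cis x) = \<bar>2 * sin (\<bar>x\<bar> / 2)\<bar>"
    by (simp only: real_sqrt_abs abs_norm_cancel)
  moreover have "2 * (\<bar>x\<bar> / 2) / pi \<le> sin (\<bar>x\<bar> / 2)"
    using assms by (intro jordan_sin) auto
  ultimately show ?thesis by simp
qed

lemma norm_one_minus_cis_shell:
  assumes "x \<in> shell n"
  shows "1 / 2 ^ n \<le> norm (1 - cis x)"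
proof -
  have "\<bar>x\<bar> \<le> pi" using shell_subset[of n] assms by (auto simp: abs_le_iff)
  then have "2 * \<bar>x\<bar> / pi \<le> norm (1 - cis x)" by (rule norm_one_minus_cis)
  moreover have "1 / 2 ^ n \<le> 2 * \<bar>x\<bar> / pi"
    using assms by (simp add: shell_def field_simps)
  ultimately show ?thesis by simp
qed

section \<open>Averages of the Fourier coefficients of a function in \<open>L\<^sub>p\<close>\<close>

abbreviation (input) circ :: "real set" where "circ \<equiv> {-pi..pi}"

lemma fourier_coeff_cis:
  "fourier_coeff f k = (LINT x:circ|lborel. f x * cis (- (of_int k * x))) / complex_of_real (2 * pi)"
  by (simp add: fourier_coeff_def cis_conv_exp mult_ac)

lemma set_integrable_mult_bounded:
  fixes f g :: "real \<Rightarrow> complex"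
  assumes f: "set_integrable lborel A f" and g: "g \<in> borel_measurable borel"
    and bd: "\<And>x. x \<in> A \<Longrightarrow> norm (g x) \<le> M"
  shows "set_integrable lborel A (\<lambda>x. f x * g x)"
  unfolding set_integrable_def
proof (rule Bochner_Integration.integrable_bound)
  show "integrable lborel (\<lambda>x. M *\<^sub>R (indicator A x *\<^sub>R f x))"
    using f unfolding set_integrable_def by (rule integrable_scaleR_right)
  have "(\<lambda>x. (indicator A x *\<^sub>R f x) * g x) \<in> borel_measurable lborel"
    using f g by (intro borel_measurable_times) (auto simp: set_integrable_def dest: borel_measurable_integrable)
  then show "(\<lambda>x. indicator A x *\<^sub>R (f x * g x)) \<in> borel_measurable lborel"
    by (simp add: scaleR_conv_of_real mult.assoc)
  have "norm (indicator A x *\<^sub>R (f x * g x)) \<le> norm (M *\<^sub>R (indicator A x *\<^sub>R f x))" for x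
  proof (cases "x \<in> A")
    case True
    then have "norm (g x) \<le> \<bar>M\<bar>" using bd[of x] by linarith
    then show ?thesis using True by (simp add: norm_mult mult.commute[of "norm (f x)"] mult_right_mono)
  qed simp
  then show "AE x in lborel. norm (indicator A x *\<^sub>R (f x * g x)) \<le> norm (M *\<^sub>R (indicator A x *\<^sub>R f x))"
    by simp
qed

lemma cis_borel [measurable]: "cis \<in> borel_measurable borel"
  by (intro borel_measurable_continuous_onI continuous_intros)

lemma set_integrable_mult_cis:
  "set_integrable lborel A f \<Longrightarrow> set_integrable lborel A (\<lambda>x. f x * cis (c * x))"
  by (rule set_integrable_mult_bounded[where M = 1]) simp_all

text \<open>Multiplication by \<open>cis x - 1\<close> telescopes the sum to a difference of two
  unit vectors, and on the shell that factor has modulus at least \<open>1 / 2 ^ m\<close>. The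
  other bound counts terms.\<close>

lemma sum_cis_bound:
  assumes "x \<in> shell m"
  shows "norm (\<Sum>l\<in>{i..<i + int L}. cis (- (of_int l * x))) \<le> min (real L) (2 * 2 ^ m)"
proof -
  let ?D = "\<Sum>l\<in>{i..<i + int L}. cis (- (of_int l * x))"
  have "norm ?D \<le> (\<Sum>l\<in>{i..<i + int L}. norm (cis (- (of_int l * x))))" by (rule norm_sum)
  then have 1: "norm ?D \<le> real L" by simp
  have "(cis x - 1) * ?D = cis (- (of_int (i - 1) * x)) - cis (- (of_int (i - 1 + int L) * x))"
  proof (induction L)
    case (Suc L)
    have "{i..<i + int (Suc L)} = insert (i + int L) {i..<i + int L}" by auto
    then have "(cis x - 1) * (\<Sum>l\<in>{i..<i + int (Suc L)}. cis (- (of_int l * x))) =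
        (cis x - 1) * cis (- (of_int (i + int L) * x)) + (cis (- (of_int (i - 1) * x)) - cis (- (of_int (i - 1 + int L) * x)))"
      using Suc by (simp add: algebra_simps)
    also have "(cis x - 1) * cis (- (of_int (i + int L) * x)) =
        cis (- (of_int (i - 1 + int L) * x)) - cis (- (of_int (i - 1 + int (Suc L)) * x))"
      by (simp add: left_diff_distrib cis_mult algebra_simps)
    finally show ?case by simp
  qed simp
  then have "norm (cis x - 1) * norm ?D = norm (cis (- (of_int (i - 1) * x)) - cis (- (of_int (i - 1 + int L) * x)))"
    by (metis norm_mult)
  also have "\<dots> \<le> 2"
    using norm_triangle_ineq4[of "cis (- (of_int (i - 1) * x))" "cis (- (of_int (i - 1 + int L) * x))"] by simp
  finally have 2: "norm (1 - cis x) * norm ?D \<le> 2" by (simp add: norm_minus_commute)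
  have "1 / 2 ^ m * norm ?D \<le> norm (1 - cis x) * norm ?D"
    by (intro mult_right_mono norm_one_minus_cis_shell assms) simp
  with 2 have "1 / 2 ^ m * norm ?D \<le> 2" by linarith
  then have "norm ?D \<le> 2 * 2 ^ m" by (simp add: field_simps)
  with 1 show ?thesis by simp
qed

lemma shells_sums:
  fixes f :: "real \<Rightarrow> real"
  assumes "set_integrable lborel circ f"
  shows "(\<lambda>n. LINT x:shell n|lborel. f x) sums (LINT x:circ|lborel. f x)"
proof -
  have int: "set_integrable lborel (\<Union>n. shell n) f"
    by (rule set_integrable_subset[OF assms]) (auto simp: shell_Union)
  have *: "(LINT x:circ|lborel. f x) = (LINT x:(\<Union>n. shell n)|lborel. f x)"
    unfolding shell_Union set_lebesgue_integral_def
  proof (rule integral_cong_AE)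
    have "(\<lambda>x. indicator circ x *\<^sub>R f x) \<in> borel_measurable lborel"
      using assms by (auto simp: set_integrable_def dest: borel_measurable_integrable)
    then show "(\<lambda>x. indicator circ x *\<^sub>R f x) \<in> borel_measurable lborel" .
    show "(\<lambda>x. indicator (circ - {0}) x *\<^sub>R f x) \<in> borel_measurable lborel"
      using int by (auto simp: shell_Union set_integrable_def dest: borel_measurable_integrable)
    show "AE x in lborel. indicator circ x *\<^sub>R f x = indicator (circ - {0}) x *\<^sub>R f x"
      using AE_lborel_singleton[of "0::real"] by eventually_elim (auto simp: indicator_def)
  qed
  have "(LINT x:circ|lborel. f x) = (\<Sum>n. LINT x:shell n|lborel. f x)"
    unfolding * using int by (intro lebesgue_integral_countable_add shell_disjoint) auto
  \<comment> \<open>Countable additivity gives the value as a \<open>suminf\<close> only;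
    convergence is shown separately by comparison with the integrals of
    \<open>\<bar>f x\<bar>\<close>, whose partial sums are integrals over finite unions of
    shells.\<close>
  moreover have "summable (\<lambda>n. LINT x:shell n|lborel. f x)"
  proof (rule summable_comparison_test)
    have absint: "set_integrable lborel circ (\<lambda>x. \<bar>f x\<bar>)" using assms by (rule set_integrable_abs)
    show "\<exists>N. \<forall>n\<ge>N. norm (LINT x:shell n|lborel. f x) \<le> (LINT x:shell n|lborel. \<bar>f x\<bar>)"
    proof (intro exI allI impI)
      fix n
      have "set_integrable lborel (shell n) f"
        by (rule set_integrable_subset[OF assms _ shell_subset]) simp
      from set_integral_norm_bound[OF this] show "norm (LINT x:shell n|lborel. f x) \<le> (LINT x:shell n|lborel. \<bar>f x\<bar>)" by simp
    qed
    show "summable (\<lambda>n. LINT x:shell n|lborel. \<bar>f x\<bar>)"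
    proof (rule summableI_nonneg_bounded)
      show "0 \<le> (LINT x:shell n|lborel. \<bar>f x\<bar>)" for n
        by (simp add: set_lebesgue_integral_def integral_nonneg_AE)
      fix N
      have "(\<Sum>n<N. LINT x:shell n|lborel. \<bar>f x\<bar>) = (LINT x:(\<Union>n<N. shell n)|lborel. \<bar>f x\<bar>)"
        by (rule set_integral_finite_Union[symmetric])
          (auto simp: disjoint_family_on_def shell_disjoint intro: set_integrable_subset[OF absint _ shell_subset])
      also have "\<dots> \<le> (LINT x:circ|lborel. \<bar>f x\<bar>)"
      proof (unfold set_lebesgue_integral_def, rule integral_mono)
        have "(\<Union>n<N. shell n) \<subseteq> circ" using shell_subset by blast
        then show "indicator (\<Union>n<N. shell n) x *\<^sub>R \<bar>f x\<bar> \<le> indicator circ x *\<^sub>R \<bar>f x\<bar>" for x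
          by (auto simp: indicator_def)
        show "integrable lborel (\<lambda>x. indicat_real (\<Union>n<N. shell n) x *\<^sub>R \<bar>f x\<bar>)"
          using set_integrable_subset[OF absint, of "\<Union>n<N. shell n"] \<open>(\<Union>n<N. shell n) \<subseteq> circ\<close>
          by (auto simp: set_integrable_def)
      qed (use absint in \<open>simp add: set_integrable_def\<close>)
      finally show "(\<Sum>n<N. LINT x:shell n|lborel. \<bar>f x\<bar>) \<le> (LINT x:circ|lborel. \<bar>f x\<bar>)" .
    qed
  qed
  ultimately show ?thesis by (simp add: summable_sums)
qed

text \<open>Optimising over \<open>\<lambda>\<close> the pointwise bound \<open>y \<le> \<lambda> + \<lambda>\<^sup>1\<^sup>-\<^sup>p y\<^sup>p\<close> gives Hoelder's inequality up to a constant.\<close>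

lemma le_add_powr:
  fixes y l p :: real
  assumes "1 < p" "0 \<le> y" "0 < l"
  shows "y \<le> l + l powr (1 - p) * y powr p"
proof (cases "y \<le> l")
  case False
  then have "y = y powr (1 - p) * y powr p"
    using assms by (simp flip: powr_add)
  also have "\<dots> \<le> l powr (1 - p) * y powr p"
    using False assms by (intro mult_right_mono powr_mono2') auto
  finally show ?thesis using assms by simp
qed (use assms in \<open>simp add: add_increasing2\<close>)

lemma shell_holder:
  fixes f :: "real \<Rightarrow> complex"
  assumes p: "1 < p" and f: "set_integrable lborel circ f"
    and fp: "set_integrable lborel circ (\<lambda>x. norm (f x) powr p)"
  shows "wt p m * (LINT x:shell m|lborel. norm (f x)) \<le> (pi + 1) * (LINT x:shell m|lborel. norm (f x) powr p) powr (1 / p)"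
proof -
  define F where "F = (LINT x:shell m|lborel. norm (f x))"
  define G where "G = (LINT x:shell m|lborel. norm (f x) powr p)"
  have f1: "set_integrable lborel (shell m) (\<lambda>x. norm (f x))"
    by (rule set_integrable_subset[OF set_integrable_norm[OF f] _ shell_subset]) simp
  have g1: "set_integrable lborel (shell m) (\<lambda>x. norm (f x) powr p)"
    by (rule set_integrable_subset[OF fp _ shell_subset]) simp
  have c1: "set_integrable lborel (shell m) (\<lambda>x. l::real)" for l
    using integrable_real_indicator[of "shell m" lborel] by (simp add: set_integrable_def emeasure_shell)
  have cI: "(LINT x:shell m|lborel. l) = l * (pi / 2 ^ m)" for l :: real
    by (subst set_integral_const) (auto simp: emeasure_shell measure_def)
  have G0: "0 \<le> G" by (simp add: G_def set_lebesgue_integral_def integral_nonneg_AE)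
  have key: "F \<le> l * (pi / 2 ^ m) + l powr (1 - p) * G" if "0 < l" for l
  proof -
    have "F \<le> (LINT x:shell m|lborel. l + l powr (1 - p) * norm (f x) powr p)"
      unfolding F_def using that p by (intro set_integral_mono f1 set_integral_add set_integrable_mult_right g1 c1 le_add_powr) auto
    also have "\<dots> = l * (pi / 2 ^ m) + l powr (1 - p) * G"
      using g1 by (subst set_integral_add) (auto simp: cI c1 G_def)
    finally show ?thesis .
  qed
  show ?thesis
  proof (cases "G = 0")
    \<comment> \<open>With \<open>G = 0\<close> the second term of \<open>key\<close> vanishes and
      \<open>l\<close> may be arbitrarily small; the value of \<open>l\<close> chosen in the other
      case would be 0.\<close>
    case True
    have "F \<le> 0"
    proof (rule field_le_epsilon)
      fix e :: real assume "0 < e"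
      then show "F \<le> 0 + e" using key[of "e / (pi / 2 ^ m)"] True by simp
    qed
    then have "wt p m * F \<le> 0" by (simp add: mult_nonneg_nonpos)
    then show ?thesis using True by (simp add: F_def G_def)
  next
    case False
    with G0 have G: "0 < G" by simp
    \<comment> \<open>This choice balances \<open>l / 2 ^ m\<close> and
      \<open>l powr (1 - p) * G\<close>, which are equal when
      \<open>l powr p = G * 2 ^ m\<close>.\<close>
    define l where "l = (G * 2 ^ m) powr (1 / p)"
    have l: "0 < l" using G by (simp add: l_def)
    have lw: "l = G powr (1 / p) * 2 ^ m / wt p m"
    proof -
      have "((2::real) ^ m) powr (1 / p) * wt p m = 2 ^ m"
        by (simp add: wt_def powr_realpow[symmetric] powr_powr algebra_simps flip: powr_add)
      then have "((2::real) ^ m) powr (1 / p) = 2 ^ m / wt p m"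
        by (simp add: eq_divide_eq)
      then show ?thesis using G by (simp add: l_def powr_mult)
    qed
    have "wt p m * (l * (pi / 2 ^ m)) = pi * G powr (1 / p)"
      by (simp add: lw)
    moreover have "wt p m * (l powr (1 - p) * G) = G powr (1 / p)"
    proof -
      have "l powr (1 - p) = l / l powr p"
        using l by (simp add: powr_diff)
      also have "l powr p = G * 2 ^ m" using G p by (simp add: l_def powr_powr)
      finally show ?thesis using G by (simp add: lw)
    qed
    ultimately show ?thesis
      using mult_left_mono[OF key[OF l], of "wt p m"] by (simp add: F_def G_def algebra_simps)
  qed
qed

lemma fourier_coeff_norm_bound:
  assumes f: "set_integrable lborel circ f"
  shows "norm (\<Sum>k\<in>A. fourier_coeff f k) * (2 * pi) \<le> (LINT x:circ|lborel. norm (f x) * norm (\<Sum>k\<in>A. cis (- (of_int k * x))))"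
proof -
  have i: "set_integrable lborel circ (\<lambda>x. f x * cis (- (of_int k * x)))" for k
    using set_integrable_mult_cis[OF f, of "- of_int k"] by simp
  have i2: "set_integrable lborel circ (\<lambda>x. \<Sum>k\<in>A. f x * cis (- (of_int k * x)))"
    unfolding set_integrable_def scaleR_sum_right
    by (rule Bochner_Integration.integrable_sum) (rule i[unfolded set_integrable_def])
  have "(LINT x:circ|lborel. \<Sum>k\<in>A. f x * cis (- (of_int k * x))) =
      (\<Sum>k\<in>A. LINT x:circ|lborel. f x * cis (- (of_int k * x)))"
    unfolding set_lebesgue_integral_def scaleR_sum_right
    by (rule Bochner_Integration.integral_sum) (rule i[unfolded set_integrable_def])
  then have "(\<Sum>k\<in>A. fourier_coeff f k) = (LINT x:circ|lborel. \<Sum>k\<in>A. f x * cis (- (of_int k * x))) / complex_of_real (2 * pi)"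
    unfolding fourier_coeff_cis sum_divide_distrib[symmetric] by simp
  then have "norm (\<Sum>k\<in>A. fourier_coeff f k) * (2 * pi) = norm (LINT x:circ|lborel. \<Sum>k\<in>A. f x * cis (- (of_int k * x)))"
    by (simp add: norm_divide)
  also have "\<dots> \<le> (LINT x:circ|lborel. norm (\<Sum>k\<in>A. f x * cis (- (of_int k * x))))"
    by (rule set_integral_norm_bound[OF i2])
  finally show ?thesis by (simp add: norm_mult flip: sum_distrib_left)
qed

lemma fourier_coeff_bounded:
  assumes "set_integrable lborel circ f"
  shows "norm (fourier_coeff f k) \<le> (LINT x:circ|lborel. norm (f x))"
proof -
  have "norm (fourier_coeff f k) * 1 \<le> norm (fourier_coeff f k) * (2 * pi)"
    using pi_gt3 by (intro mult_left_mono) auto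
  then show ?thesis using fourier_coeff_norm_bound[OF assms, of "{k}"] by simp
qed

text \<open>\<open>shell_holder\<close> replaces the integral of the modulus over a shell by the
  norm \<open>b m\<close> of f on that shell. The Schur kernel then acts on \<open>b\<close>, whose
  p-th powers add up to the full integral.\<close>

lemma avg_bound_Lp:
  assumes p: "1 < p"
  shows "\<exists>K>0. \<forall>f. set_integrable lborel circ f \<longrightarrow> set_integrable lborel circ (\<lambda>x. norm (f x) powr p) \<longrightarrow>
    (\<exists>R. avg_bound (fourier_coeff f) R \<and> summable (\<lambda>n. (wt p n * R n) powr p) \<and>
      (\<Sum>n. (wt p n * R n) powr p) \<le> K * (LINT x:circ|lborel. norm (f x) powr p))"
proof -
  have d: "0 < decay p" and p0: "0 < p" using p by (auto intro: decay_pos)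
  obtain K where K: "0 < K" and sch: "\<forall>b. (\<forall>m. 0 \<le> b m) \<longrightarrow> summable (\<lambda>m. b m powr p) \<longrightarrow>
       summable (\<lambda>n. (\<Sum>m. kern (decay p) n m * b m) powr p) \<and>
       (\<Sum>n. (\<Sum>m. kern (decay p) n m * b m) powr p) \<le> K * (\<Sum>m. b m powr p)"
    using kern_schur[OF d p0] by blast
  have main: "\<exists>R. avg_bound (fourier_coeff f) R \<and> summable (\<lambda>n. (wt p n * R n) powr p) \<and>
      (\<Sum>n. (wt p n * R n) powr p) \<le> ((pi + 1) powr p * K) * (LINT x:circ|lborel. norm (f x) powr p)"
    if f: "set_integrable lborel circ f" and fp: "set_integrable lborel circ (\<lambda>x. norm (f x) powr p)"
    for f :: "real \<Rightarrow> complex"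
  proof -
    define F where "F m = (LINT x:shell m|lborel. norm (f x))" for m
    define G where "G m = (LINT x:shell m|lborel. norm (f x) powr p)" for m
    define b where "b m = G m powr (1 / p)" for m
    have F0: "0 \<le> F m" for m by (simp add: F_def set_lebesgue_integral_def integral_nonneg_AE)
    have G0: "0 \<le> G m" for m by (simp add: G_def set_lebesgue_integral_def integral_nonneg_AE)
    have bp: "b m powr p = G m" for m using p G0[of m] by (simp add: b_def powr_powr)
    have Gs: "G sums (LINT x:circ|lborel. norm (f x) powr p)"
      unfolding G_def by (rule shells_sums[OF fp])
    have Fs: "summable F"
      unfolding F_def by (rule sums_summable[OF shells_sums[OF set_integrable_norm[OF f]]])
    \<comment> \<open>For \<open>L >= 2 ^ n\<close> the bound \<open>min L (2 * 2 ^ m)\<close> of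
      the exponential sum is at most \<open>2 * L * min 1 (2 powr (m - n))\<close>. So the length
      factors out, and the 2 is absorbed by the \<open>2 * pi\<close> in the normalisation of the
      coefficients.\<close>
    define R where "R n = (\<Sum>m. min 1 (2 powr (real m - real n)) * F m)" for n
    have sR: "summable (\<lambda>m. min 1 (2 powr (real m - real n)) * F m)" for n
      by (rule summable_comparison_test'[OF Fs]) (use F0 in \<open>simp add: mult_left_le_one_le\<close>)
    have R0: "0 \<le> R n" for n unfolding R_def using sR F0 by (intro suminf_nonneg) auto
    have avg: "avg_bound (fourier_coeff f) R"
      unfolding avg_bound_def
    proof (intro allI impI)
      fix i :: int and L n :: nat assume L: "2 ^ n \<le> L"
      let ?D = "\<lambda>x. \<Sum>l\<in>{i..<i + int L}. cis (- (of_int l * x))"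
      have Dm: "?D \<in> borel_measurable borel" by measurable
      have Db: "norm (?D x) \<le> real L" for x
        using norm_sum[of "\<lambda>l. cis (- (of_int l * x))" "{i..<i + int L}"] by simp
      have "set_integrable lborel circ (\<lambda>x. norm (f x * ?D x))"
        by (rule set_integrable_norm[OF set_integrable_mult_bounded[OF f Dm Db]])
      then have int: "set_integrable lborel circ (\<lambda>x. norm (f x) * norm (?D x))" by (simp add: norm_mult)
      have shell_le: "(LINT x:shell m|lborel. norm (f x) * norm (?D x)) \<le> 2 * real L * (min 1 (2 powr (real m - real n)) * F m)" for m
      proof -
        have c: "min (real L) (2 * 2 ^ m) \<le> 2 * real L * min 1 (2 powr (real m - real n))"
        proof -
          have "real (2 ^ n) \<le> real L" using L by (simp only: of_nat_le_iff)
          then have "2 * 2 ^ m * 1 \<le> 2 * 2 ^ m * (real L / 2 ^ n)" by (intro mult_left_mono) auto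
          then have *: "2 * 2 ^ m \<le> 2 * real L * 2 powr (real m - real n)"
            by (simp add: powr_diff powr_realpow field_simps)
          then show ?thesis
          proof (cases "1 \<le> 2 powr (real m - real n)")
            case True
            then have "min 1 (2 powr (real m - real n)) = 1" by (simp only: min_absorb1)
            moreover have "min (real L) (2 * 2 ^ m) \<le> real L" by simp
            ultimately show ?thesis by simp
          next
            case False
            then have "min 1 (2 powr (real m - real n)) = 2 powr (real m - real n)" by simp
            with * show ?thesis by (simp add: min.coboundedI2)
          qed
        qed
        have "(LINT x:shell m|lborel. norm (f x) * norm (?D x)) \<le> (LINT x:shell m|lborel. norm (f x) * (2 * real L * min 1 (2 powr (real m - real n))))"
        proof (rule set_integral_mono)
          show "set_integrable lborel (shell m) (\<lambda>x. norm (f x) * norm (?D x))"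
            by (rule set_integrable_subset[OF int _ shell_subset]) simp
          show "set_integrable lborel (shell m) (\<lambda>x. norm (f x) * (2 * real L * min 1 (2 powr (real m - real n))))"
            by (intro set_integrable_mult_left set_integrable_subset[OF set_integrable_norm[OF f] _ shell_subset]) simp
          fix x assume "x \<in> shell m"
          then show "norm (f x) * norm (?D x) \<le> norm (f x) * (2 * real L * min 1 (2 powr (real m - real n)))"
            by (intro mult_left_mono order_trans[OF sum_cis_bound c]) auto
        qed
        then show ?thesis by (simp add: F_def mult_ac)
      qed
      have "norm (\<Sum>l\<in>{i..<i + int L}. fourier_coeff f l) * (2 * pi) \<le> (LINT x:circ|lborel. norm (f x) * norm (?D x))"
        by (rule fourier_coeff_norm_bound[OF f])
      also have "\<dots> = (\<Sum>m. LINT x:shell m|lborel. norm (f x) * norm (?D x))"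
        using shells_sums[OF int] by (simp add: sums_iff)
      also have "\<dots> \<le> (\<Sum>m. 2 * real L * (min 1 (2 powr (real m - real n)) * F m))"
        using shells_sums[OF int] sR by (intro suminf_le shell_le) (auto simp: sums_iff)
      also have "\<dots> = 2 * real L * R n"
        unfolding R_def by (rule suminf_mult[OF sR])
      also have "\<dots> \<le> real L * R n * (2 * pi)"
        using mult_left_mono[of 2 "2 * pi" "real L * R n"] R0[of n] pi_gt3 by (simp add: mult_ac)
      finally show "norm (\<Sum>l\<in>{i..<i + int L}. fourier_coeff f l) \<le> real L * R n" by simp
    qed
    have sk: "summable (\<lambda>m. kern (decay p) n m * b m)" for n
      using p d Gs by (intro kern_mult_summable[OF d p0]) (auto simp: bp sums_iff, simp add: b_def)
    have le: "wt p n * R n \<le> (pi + 1) * (\<Sum>m. kern (decay p) n m * b m)" for n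
    proof -
      have "wt p n * R n = (\<Sum>m. wt p n * (min 1 (2 powr (real m - real n)) * F m))"
        unfolding R_def by (rule suminf_mult[OF sR, symmetric])
      also have "\<dots> \<le> (\<Sum>m. (pi + 1) * (kern (decay p) n m * b m))"
      proof (rule suminf_le)
        fix m
        have "wt p n * (min 1 (2 powr (real m - real n)) * F m) \<le> kern (decay p) n m * (wt p m * F m)"
          using mult_right_mono[OF wt_kern_min[OF p, of n m] F0[of m]] by (simp add: mult.assoc)
        also have "\<dots> \<le> kern (decay p) n m * ((pi + 1) * b m)"
          using shell_holder[OF p f fp, of m] by (intro mult_left_mono) (auto simp: F_def G_def b_def)
        finally show "wt p n * (min 1 (2 powr (real m - real n)) * F m) \<le> (pi + 1) * (kern (decay p) n m * b m)"
          by (simp add: mult_ac)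
      qed (use sR sk in \<open>auto intro: summable_mult\<close>)
      also have "\<dots> = (pi + 1) * (\<Sum>m. kern (decay p) n m * b m)"
        by (rule suminf_mult[OF sk])
      finally show ?thesis .
    qed
    have pi1: "0 < pi + 1" by (simp add: add_pos_pos)
    have "summable (\<lambda>n. ((pi + 1) * (wt p n * R n / (pi + 1))) powr p) \<and>
       (\<Sum>n. ((pi + 1) * (wt p n * R n / (pi + 1))) powr p) \<le> (pi + 1) powr p * (K * (\<Sum>m. b m powr p))"
    proof (rule suminf_powr_le[OF p0, where y = "\<lambda>n. \<Sum>m. kern (decay p) n m * b m"])
      show "wt p n * R n / (pi + 1) \<le> (\<Sum>m. kern (decay p) n m * b m)" for n
        using le[of n] pi1 by (simp add: field_simps)
      show "0 \<le> wt p n * R n / (pi + 1)" for n using R0[of n] pi1 by simp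
      have "summable (\<lambda>n. (\<Sum>m. kern (decay p) n m * b m) powr p) \<and>
       (\<Sum>n. (\<Sum>m. kern (decay p) n m * b m) powr p) \<le> K * (\<Sum>m. b m powr p)"
        using Gs by (intro sch[rule_format]) (auto simp: bp sums_iff, simp add: b_def)
      then show "summable (\<lambda>n. (\<Sum>m. kern (decay p) n m * b m) powr p)" 
        "(\<Sum>n. (\<Sum>m. kern (decay p) n m * b m) powr p) \<le> K * (\<Sum>m. b m powr p)" by auto
    qed (use pi1 in simp)
    then show ?thesis using avg Gs pi1 by (auto simp: bp sums_iff mult.assoc)
  qed
  have "pi + 1 \<noteq> 0" using pi_gt_zero by linarith
  then have "0 < (pi + 1) powr p * K" using K by simp
  then show ?thesis using main by blast
qed

section \<open>Uniqueness of Fourier coefficients\<close>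

definition null_coeffs :: "(real \<Rightarrow> complex) \<Rightarrow> bool" where
  "null_coeffs h \<longleftrightarrow> set_integrable lborel circ h \<and>
     (\<forall>k::int. (LINT x:circ|lborel. h x * cis (- (of_int k * x))) = 0)"

lemma null_coeffs_integrable:
  "null_coeffs h \<Longrightarrow> set_integrable lborel circ (\<lambda>x. h x * cis (- (of_int k * x)))"
  using set_integrable_mult_cis[of circ h "- of_int k"] by (simp add: null_coeffs_def)

lemma null_coeffs_add:
  assumes "null_coeffs g" "null_coeffs h"
  shows "null_coeffs (\<lambda>x. g x + h x)"
  using assms null_coeffs_integrable[OF assms(1)] null_coeffs_integrable[OF assms(2)]
  by (auto simp: null_coeffs_def distrib_right)

lemma null_coeffs_mult:
  assumes "null_coeffs h"
  shows "null_coeffs (\<lambda>x. c * h x)"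
  using assms by (auto simp: null_coeffs_def mult.assoc)

lemma null_coeffs_cis:
  assumes "null_coeffs h"
  shows "null_coeffs (\<lambda>x. h x * cis (of_int j * x))"
  unfolding null_coeffs_def
proof (intro conjI allI)
  show "set_integrable lborel circ (\<lambda>x. h x * cis (of_int j * x))"
    using assms by (intro set_integrable_mult_cis) (simp add: null_coeffs_def)
  fix k
  have eq: "h x * cis (of_int j * x) * cis (- (of_int k * x)) = h x * cis (- (of_int (k - j) * x))" for x
    by (simp add: mult.assoc cis_mult algebra_simps)
  have "(LINT x:circ|lborel. h x * cis (- (of_int (k - j) * x))) = 0"
    using assms unfolding null_coeffs_def by blast
  then show "(LINT x:circ|lborel. h x * cis (of_int j * x) * cis (- (of_int k * x))) = 0"
    by (simp only: eq)
qed

lemma null_coeffs_cos_sin: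
  assumes "null_coeffs h"
  shows "null_coeffs (\<lambda>x. h x * of_real (c * cos x + s * sin x))"
proof -
  \<comment> \<open>Euler's formulas: the coefficients of \<open>cis x\<close> and
    \<open>cis (- x)\<close> in \<open>c * cos x + s * sin x\<close>.\<close>
  let ?u = "(of_real c - \<i> * of_real s) / 2" and ?v = "(of_real c + \<i> * of_real s) / 2"
  have "h x * of_real (c * cos x + s * sin x) =
      ?u * (h x * cis (of_int 1 * x)) + ?v * (h x * cis (of_int (-1) * x))" for x
    by (simp add: complex_eq_iff algebra_simps add_divide_distrib diff_divide_distrib)
  then show ?thesis
    using assms by (simp only:) (intro null_coeffs_add null_coeffs_mult null_coeffs_cis)
qed

text \<open>Quantifying over all \<open>h\<close> with vanishing coefficients makes the induction pass through products.\<close>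

lemma null_coeffs_poly:
  assumes "real_polynomial_function q"
  shows "null_coeffs h \<Longrightarrow> null_coeffs (\<lambda>x. h x * of_real (q (cis x)))"
  using assms
proof (induction q arbitrary: h)
  \<comment> \<open>A real-linear functional on the plane restricts to the unit circle as a
    combination of cosine and sine.\<close>
  case (linear q)
  interpret bounded_linear q by fact
  have "cis x = cos x *\<^sub>R 1 + sin x *\<^sub>R \<i>" for x
    by (simp add: complex_eq_iff)
  then have "q (cis x) = q 1 * cos x + q \<i> * sin x" for x
    by (metis add scaleR real_scaleR_def mult.commute)
  then show ?case using null_coeffs_cos_sin[OF linear.prems] by (simp only:)
next
  case (const c)
  then show ?case using null_coeffs_mult[of h "of_real c"] by (simp add: mult.commute)
next
  case (add f g)
  then show ?case using null_coeffs_add[OF add.IH(1) add.IH(2)] by (simp add: distrib_left)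
next
  case (mult f g)
  then show ?case using mult.IH(2)[OF mult.IH(1)[OF mult.prems]] by (simp add: mult.assoc)
qed

text \<open>Polynomials in the plane are uniformly dense among continuous functions on the circle,
  and integration against \<open>h\<close> is continuous in the uniform norm with constant
  \<open>N\<close>. Composing with \<open>cis\<close> builds the 2 pi periodicity in.\<close>

lemma null_coeffs_continuous:
  assumes h: "null_coeffs h" and phi: "continuous_on UNIV (\<phi> :: complex \<Rightarrow> real)"
  shows "set_integrable lborel circ (\<lambda>x. h x * of_real (\<phi> (cis x)))"
    and "(LINT x:circ|lborel. h x * of_real (\<phi> (cis x))) = 0"
proof -
  have hint: "set_integrable lborel circ h" using h by (simp add: null_coeffs_def)
  have phi_m [measurable]: "\<phi> \<in> borel_measurable borel"
    by (rule borel_measurable_continuous_onI[OF phi])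
  have "compact (\<phi> ` sphere 0 1)"
    by (intro compact_continuous_image continuous_on_subset[OF phi]) auto
  then obtain M where M: "\<forall>z\<in>\<phi> ` sphere 0 1. norm z \<le> M"
    using compact_imp_bounded bounded_iff by metis
  show int: "set_integrable lborel circ (\<lambda>x. h x * of_real (\<phi> (cis x)))"
    by (rule set_integrable_mult_bounded[OF hint, of _ M]) (use M in auto)
  define N where "N = (LINT x:circ|lborel. norm (h x))"
  have N0: "0 \<le> N" by (simp add: N_def set_lebesgue_integral_def integral_nonneg_AE)
  have "norm (LINT x:circ|lborel. h x * of_real (\<phi> (cis x))) \<le> 0 + e" if e: "0 < e" for e
  proof -
    define e' where "e' = e / (N + 1)"
    have e': "0 < e'" using e N0 by (simp add: e'_def)
    obtain q where q: "real_polynomial_function q" and qe: "\<And>z. z \<in> sphere 0 1 \<Longrightarrow> \<bar>\<phi> z - q z\<bar> < e'"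
      using Stone_Weierstrass_real_polynomial_function[of "sphere (0::complex) 1" \<phi> e'] e'
        continuous_on_subset[OF phi] by auto
    have nq: "null_coeffs (\<lambda>x. h x * of_real (q (cis x)))" by (rule null_coeffs_poly[OF q h])
    have "(LINT x:circ|lborel. h x * of_real (q (cis x)) * cis (- (of_int 0 * x))) = 0"
      using nq unfolding null_coeffs_def by blast
    then have "(LINT x:circ|lborel. h x * of_real (\<phi> (cis x))) =
        (LINT x:circ|lborel. h x * of_real (\<phi> (cis x))) - (LINT x:circ|lborel. h x * of_real (q (cis x)))"
      by simp
    also have "\<dots> = (LINT x:circ|lborel. h x * of_real (\<phi> (cis x)) - h x * of_real (q (cis x)))"
      using int nq by (intro set_integral_diff(2)[symmetric]) (auto simp: null_coeffs_def)
    finally have "norm (LINT x:circ|lborel. h x * of_real (\<phi> (cis x))) \<le>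
        (LINT x:circ|lborel. norm (h x * of_real (\<phi> (cis x)) - h x * of_real (q (cis x))))"
      using set_integral_norm_bound[OF set_integral_diff(1)[OF int, of "\<lambda>x. h x * of_real (q (cis x))"]] nq
      by (simp add: null_coeffs_def)
    also have "\<dots> \<le> (LINT x:circ|lborel. norm (h x) * e')"
    proof (rule set_integral_mono)
      show "set_integrable lborel circ (\<lambda>x. norm (h x * of_real (\<phi> (cis x)) - h x * of_real (q (cis x))))"
        using int nq by (intro set_integrable_norm set_integral_diff(1)) (auto simp: null_coeffs_def)
      show "set_integrable lborel circ (\<lambda>x. norm (h x) * e')"
        by (intro set_integrable_mult_left set_integrable_norm hint)
      fix x
      have "norm (h x * of_real (\<phi> (cis x)) - h x * of_real (q (cis x))) = norm (h x) * \<bar>\<phi> (cis x) - q (cis x)\<bar>"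
        by (simp only: right_diff_distrib[symmetric] of_real_diff[symmetric] norm_mult norm_of_real)
      also have "\<dots> \<le> norm (h x) * e'"
        using qe[of "cis x"] by (intro mult_left_mono) auto
      finally show "norm (h x * of_real (\<phi> (cis x)) - h x * of_real (q (cis x))) \<le> norm (h x) * e'" .
    qed
    also have "\<dots> = N * e'" by (simp add: N_def)
    also have "\<dots> \<le> e" using e N0 by (simp add: e'_def field_simps)
    finally show ?thesis by simp
  qed
  then have "norm (LINT x:circ|lborel. h x * of_real (\<phi> (cis x))) \<le> 0"
    by (rule field_le_epsilon)
  then show "(LINT x:circ|lborel. h x * of_real (\<phi> (cis x))) = 0" by simp
qed

lemma null_coeffs_compact:
  assumes h: "null_coeffs h" and K: "compact K" "K \<subseteq> {-pi<..<pi}"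
  shows "(LINT x:K|lborel. h x) = 0"
proof (cases "K = {}")
  \<comment> \<open>\<open>infdist\<close> to the empty set is 0 by convention, so the bumps would
    be constantly 1 for an empty \<open>K\<close>.\<close>
  case False
  have hint: "set_integrable lborel circ h" using h by (simp add: null_coeffs_def)
  define \<phi> where "\<phi> n z = max 0 (1 - real n * infdist z (cis ` K))" for n z
  have cont: "continuous_on UNIV (\<phi> n)" for n
    unfolding \<phi>_def by (intro continuous_intros)
  have cl: "closed (cis ` K)"
    by (intro compact_imp_closed compact_continuous_image continuous_intros K)
  have mem: "x \<in> K" if x: "x \<in> circ" "cis x \<in> cis ` K" for x
  proof -
    obtain y where y: "y \<in> K" "cis x = cis y" using x by auto
    have Arg_y: "Arg (cis y) = y" using y K by (intro Arg_cis) auto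
    show ?thesis
    proof (cases "x = -pi")
      case True
      moreover have "cis (- pi) = cis pi" by (simp add: complex_eq_iff)
      ultimately have "cis y = cis pi" using y by metis
      then have "y = pi" using Arg_y Arg_cis[of pi] by simp
      then show ?thesis using y K by auto
    next
      case False
      then have "Arg (cis x) = x" using x by (intro Arg_cis) auto
      then show ?thesis using y Arg_y by simp
    qed
  qed
  have "(\<lambda>n. LINT x:circ|lborel. h x * of_real (\<phi> n (cis x))) \<longlonglongrightarrow> (LINT x:K|lborel. h x)"
    unfolding set_lebesgue_integral_def
  proof (rule integral_dominated_convergence)
    have "K \<subseteq> circ" using K by auto
    moreover have "K \<in> sets borel" using K by (intro borel_closed compact_imp_closed)
    ultimately have "set_integrable lborel K h"
      by (intro set_integrable_subset[OF hint]) auto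
    then show "(\<lambda>x. indicator K x *\<^sub>R h x) \<in> borel_measurable lborel"
      by (auto simp: set_integrable_def dest: borel_measurable_integrable)
    show "(\<lambda>x. indicator circ x *\<^sub>R (h x * of_real (\<phi> n (cis x)))) \<in> borel_measurable lborel" for n
      using null_coeffs_continuous(1)[OF h cont] by (auto simp: set_integrable_def dest: borel_measurable_integrable)
    show "integrable lborel (\<lambda>x. indicator circ x *\<^sub>R norm (h x))"
      using set_integrable_norm[OF hint] by (simp add: set_integrable_def)
    have "norm (h x * of_real (\<phi> n (cis x))) \<le> norm (h x)" for n x
    proof -
      have "0 \<le> \<phi> n (cis x)" "\<phi> n (cis x) \<le> 1" by (auto simp: \<phi>_def infdist_nonneg)
      then show ?thesis by (simp add: norm_mult mult_left_le)
    qed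
    then show "AE x in lborel. norm (indicator circ x *\<^sub>R (h x * of_real (\<phi> n (cis x)))) \<le> indicator circ x *\<^sub>R norm (h x)" for n
      by (auto simp: indicator_def)
    show "AE x in lborel. (\<lambda>n. indicator circ x *\<^sub>R (h x * of_real (\<phi> n (cis x)))) \<longlonglongrightarrow> indicator K x *\<^sub>R h x"
    proof (rule AE_I2)
      fix x
      consider "x \<notin> circ" | "x \<in> K" "x \<in> circ" | "x \<in> circ" "x \<notin> K" by blast
      then show "(\<lambda>n. indicator circ x *\<^sub>R (h x * of_real (\<phi> n (cis x)))) \<longlonglongrightarrow> indicator K x *\<^sub>R h x"
      proof cases
        case 1
        then have "x \<notin> K" using \<open>K \<subseteq> circ\<close> by auto
        then show ?thesis using 1 by simp
      next
        case 2
        then have "\<phi> n (cis x) = 1" for n by (simp add: \<phi>_def)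
        then show ?thesis using 2 by simp
      next
        case 3
        then have "cis x \<notin> cis ` K" using mem by blast
        then have pos: "0 < infdist (cis x) (cis ` K)"
          using cl False by (simp add: infdist_pos_not_in_closed)
        obtain n0 where n0: "1 < real n0 * infdist (cis x) (cis ` K)"
          using reals_Archimedean3[OF pos] by blast
        have "eventually (\<lambda>n. \<phi> n (cis x) = 0) sequentially"
          using eventually_ge_at_top[of n0]
        proof eventually_elim
          fix n assume "n0 \<le> n"
          then have "real n0 * infdist (cis x) (cis ` K) \<le> real n * infdist (cis x) (cis ` K)"
            using pos by (intro mult_right_mono) auto
          then show "\<phi> n (cis x) = 0" using n0 by (simp add: \<phi>_def)
        qed
        then have "eventually (\<lambda>n. indicator circ x *\<^sub>R (h x * of_real (\<phi> n (cis x))) = indicator K x *\<^sub>R h x) sequentially"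
          by eventually_elim (use 3 in simp)
        then show ?thesis by (rule tendsto_eventually)
      qed
    qed
  qed
  then show ?thesis
    using null_coeffs_continuous(2)[OF h cont] LIMSEQ_unique[OF tendsto_const[of 0]] by simp
qed (simp add: set_lebesgue_integral_def)

text \<open>Inner regularity: the set where \<open>u\<close> is positive contains a closed set
  \<open>T\<close> missing only measure \<open>e\<close>. A positive integrand with integral 0 over
  the compact set \<open>T\<close> forces \<open>T\<close> to be null, so the whole set has measure
  at most \<open>e\<close>.\<close>

lemma AE_nonpos_of_compact:
  fixes u :: "real \<Rightarrow> real"
  assumes u: "set_integrable lborel circ u"
    and null: "\<And>K. compact K \<Longrightarrow> K \<subseteq> {-pi<..<pi} \<Longrightarrow> (LINT x:K|lborel. u x) = 0"
  shows "AE x in lborel. x \<in> {-pi<..<pi} \<longrightarrow> u x \<le> 0"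
proof -
  define E where "E = {x \<in> {-pi<..<pi}. 0 < u x}"
  have um: "(\<lambda>x. indicator circ x *\<^sub>R u x) \<in> borel_measurable lborel"
    using u by (auto simp: set_integrable_def dest: borel_measurable_integrable)
  have "E = {x \<in> space lborel. 0 < indicator circ x *\<^sub>R u x} \<inter> {-pi<..<pi}"
    by (auto simp: E_def indicator_def)
  then have Em: "E \<in> sets lborel"
    using borel_measurable_less[OF borel_measurable_const um, of 0] by simp
  have "emeasure lebesgue E \<le> 0 + ennreal e" if e: "0 < e" for e
  proof -
    have El: "E \<in> sets lebesgue" using Em by simp
    obtain T where T: "closed T" "T \<subseteq> E" "E - T \<in> lmeasurable" "emeasure lebesgue (E - T) < ennreal e"
      by (rule sets_lebesgue_inner_closed[OF El e])
    have "T \<subseteq> circ" using T by (auto simp: E_def)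
    then have "bounded T" by (rule bounded_subset[OF compact_imp_bounded[OF compact_Icc]])
    then have cT: "compact T" using T by (simp add: compact_eq_bounded_closed)
    have Tb: "T \<in> sets lborel" using T by simp
    have sub: "T \<subseteq> {-pi<..<pi}" "T \<subseteq> circ" using T by (auto simp: E_def)
    have upos: "0 < u x" if "x \<in> T" for x using T(2) that by (auto simp: E_def)
    have iT: "integrable lborel (\<lambda>x. indicator T x *\<^sub>R u x)"
      using set_integrable_subset[OF u Tb sub(2)] by (simp add: set_integrable_def)
    have "AE x in lborel. indicator T x *\<^sub>R u x = 0"
    proof (subst integral_nonneg_eq_0_iff_AE[OF iT, symmetric])
      show "AE x in lborel. 0 \<le> indicator T x *\<^sub>R u x"
        using upos by (intro AE_I2) (simp add: indicator_def less_imp_le)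
      show "(LINT x|lborel. indicator T x *\<^sub>R u x) = 0"
        using null[OF cT sub(1)] by (simp add: set_lebesgue_integral_def)
    qed
    then have "AE x in lborel. x \<notin> T"
    proof eventually_elim
      fix x assume "indicator T x *\<^sub>R u x = 0"
      then show "x \<notin> T" using upos[of x] by (cases "x \<in> T") auto
    qed
    then have "T \<in> null_sets lebesgue"
      using AE_iff_null_sets[OF Tb] null_sets_completionI by blast
    then have "emeasure lebesgue (E - T) = emeasure lebesgue E"
      using El by (rule emeasure_Diff_null_set)
    then show ?thesis using T(4) by (simp only: add_0 less_imp_le)
  qed
  then have "emeasure lebesgue E \<le> 0"
    by (rule ennreal_le_epsilon)
  then have "emeasure lebesgue E = 0" by (simp only: le_zero_eq)
  moreover have "E \<in> sets lebesgue" using Em by simp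
  ultimately have "E \<in> null_sets lebesgue" by (rule null_setsI)
  then have "E \<in> null_sets lborel" by (simp only: null_sets_completion_iff[OF Em])
  then have "AE x in lborel. x \<notin> E" by (rule AE_not_in)
  then show ?thesis by eventually_elim (auto simp: E_def not_less)
qed

text \<open>One-sided bounds for Re, Im and their negatives combine to equality with 0; the two end
  points, which the compact sets avoid, form a null set.\<close>

lemma null_coeffs_AE:
  assumes h: "null_coeffs h"
  shows "AE x in lborel. x \<in> circ \<longrightarrow> h x = 0"
proof -
  have hint: "set_integrable lborel circ h" using h by (simp add: null_coeffs_def)
  have nonpos: "AE x in lborel. x \<in> {-pi<..<pi} \<longrightarrow> L (h x) \<le> 0" if L: "bounded_linear L" for L :: "complex \<Rightarrow> real"
  proof (rule AE_nonpos_of_compact)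
    interpret bounded_linear L by fact
    show "set_integrable lborel circ (\<lambda>x. L (h x))"
      using integrable_bounded_linear[OF L hint[unfolded set_integrable_def]]
      by (simp add: set_integrable_def scaleR)
    fix K :: "real set" assume K: "compact K" "K \<subseteq> {-pi<..<pi}"
    have "set_integrable lborel K h"
      using K by (intro set_integrable_subset[OF hint]) (auto intro: borel_closed compact_imp_closed)
    from integral_bounded_linear[OF L this[unfolded set_integrable_def]]
    have "(LINT x:K|lborel. L (h x)) = L (LINT x:K|lborel. h x)"
      by (simp add: set_lebesgue_integral_def scaleR)
    then show "(LINT x:K|lborel. L (h x)) = 0"
      using null_coeffs_compact[OF h K] zero by simp
  qed
  have "AE x in lborel. x \<noteq> - pi" "AE x in lborel. x \<noteq> pi"
    by (rule AE_lborel_singleton)+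
  moreover note nonpos[OF bounded_linear_Re] nonpos[OF bounded_linear_Im]
    nonpos[OF bounded_linear_minus[OF bounded_linear_Re]] nonpos[OF bounded_linear_minus[OF bounded_linear_Im]]
  ultimately show ?thesis
    by eventually_elim (auto simp: complex_eq_iff)
qed

section \<open>Pointwise bounds for the partial sums\<close>

text \<open>Summation by parts leaves two boundary terms and the variation, each at most
  \<open>B\<close>; hence the factor 3.\<close>

lemma abel_bound:
  fixes b :: "nat \<Rightarrow> complex"
  assumes z: "norm z = 1" and bd: "\<And>j. M \<le> j \<Longrightarrow> norm (b j) \<le> B"
    and var: "\<And>N. (\<Sum>j\<in>{M..<N}. norm (b j - b (Suc j))) \<le> B"
  shows "norm (1 - z) * norm (\<Sum>k\<in>{M..<N}. b k * z ^ k) \<le> 3 * B"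
proof (cases "M \<le> N")
  case True
  have "(1 - z) * (\<Sum>k\<in>{M..<N}. b k * z ^ k) =
      b M * z ^ M - b N * z ^ N - (\<Sum>k\<in>{M..<N}. (b k - b (Suc k)) * z ^ Suc k)"
    using True by (induction N rule: dec_induct) (simp_all add: algebra_simps)
  then have "norm (1 - z) * norm (\<Sum>k\<in>{M..<N}. b k * z ^ k) =
      norm (b M * z ^ M - b N * z ^ N - (\<Sum>k\<in>{M..<N}. (b k - b (Suc k)) * z ^ Suc k))"
    by (metis norm_mult)
  also have "\<dots> \<le> norm (b M * z ^ M) + norm (b N * z ^ N) + norm (\<Sum>k\<in>{M..<N}. (b k - b (Suc k)) * z ^ Suc k)"
    by (meson add_right_mono norm_triangle_ineq4 order_trans)
  also have "norm (\<Sum>k\<in>{M..<N}. (b k - b (Suc k)) * z ^ Suc k) \<le> (\<Sum>k\<in>{M..<N}. norm (b k - b (Suc k)))"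
    using z by (intro sum_norm_le) (simp add: norm_mult norm_power)
  also have "norm (b M * z ^ M) + norm (b N * z ^ N) + (\<Sum>k\<in>{M..<N}. norm (b k - b (Suc k))) \<le> B + B + B"
    using z bd[of M] bd[of N] True by (intro add_mono var) (simp_all add: norm_mult norm_power)
  finally show ?thesis by simp
next
  case False
  then show ?thesis using order_trans[OF norm_ge_zero bd[of M]] by simp
qed

definition partial_sum :: "(int \<Rightarrow> complex) \<Rightarrow> nat \<Rightarrow> real \<Rightarrow> complex" where
  "partial_sum a N x = (\<Sum>k\<in>{- int (Suc N)<..<int (Suc N)}. a k * cis (of_int k * x))"

context
  fixes a :: "int \<Rightarrow> complex" and B :: "nat \<Rightarrow> real"
  assumes B: "tail_majorant a B"
begin

lemma tail_majorant_norm: "int (2 ^ n div 2) \<le> \<bar>k\<bar> \<Longrightarrow> norm (a k) \<le> B n"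
  using B by (simp add: tail_majorant_def)

lemma tail_majorant_nonneg: "0 \<le> B n"
  using order_trans[OF norm_ge_zero tail_majorant_norm[of n "int (2 ^ n div 2)"]] by simp

text \<open>The level \<open>n\<close> of the point and the level \<open>i\<close> of the starting
  index are independent: \<open>i = Suc n\<close> serves the size bound, arbitrarily large
  \<open>i\<close> the Cauchy criterion.\<close>

lemma side_tail_bound:
  assumes s: "s = 1 \<or> s = (-1::int)" and x: "x \<in> shell n" and M: "2 ^ i div 2 \<le> M"
  shows "norm (\<Sum>k\<in>{M..<N}. a (s * int k) * cis (of_int s * x) ^ k) \<le> 3 * 2 ^ n * B i"
proof -
  have "of_int s * x \<in> shell n" using s x by (auto simp: shell_def)
  from norm_one_minus_cis_shell[OF this] have 1: "1 / 2 ^ n \<le> norm (1 - cis (of_int s * x))" .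
  have 2: "norm (1 - cis (of_int s * x)) * norm (\<Sum>k\<in>{M..<N}. a (s * int k) * cis (of_int s * x) ^ k) \<le> 3 * B i"
  proof (rule abel_bound)
    fix j assume "M \<le> j"
    then have "int (2 ^ i div 2) \<le> int j" using M by (simp only: of_nat_le_iff)
    then show "norm (a (s * int j)) \<le> B i"
      using s by (intro tail_majorant_norm) (auto simp: abs_mult)
  next
    show "(\<Sum>j\<in>{M..<N}. norm (a (s * int j) - a (s * int (Suc j)))) \<le> B i" for N
      using B s M unfolding tail_majorant_def by blast
  qed simp
  have "1 / 2 ^ n * norm (\<Sum>k\<in>{M..<N}. a (s * int k) * cis (of_int s * x) ^ k) \<le> 3 * B i"
    by (rule order_trans[OF mult_right_mono[OF 1 norm_ge_zero] 2])
  then show ?thesis by (simp add: field_simps)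
qed

lemma side_head_bound:
  assumes s: "s = 1 \<or> s = (-1::int)"
  shows "(\<Sum>k<2 ^ n. norm (a (s * int k))) \<le> (\<Sum>j\<le>n. 2 ^ j * B j)"
proof -
  have "(\<Sum>k<2 ^ n. norm (a (s * int k))) =
      norm (a 0) + (\<Sum>j<n. \<Sum>k\<in>{2 ^ j..<2 ^ Suc j}. norm (a (s * int k)))"
    by (subst sum_dyadic) simp
  \<comment> \<open>Indices in \<open>{2 ^ j..<2 ^ Suc j}\<close> reach the threshold of level j +
    1, so \<open>B (Suc j)\<close> applies; their number \<open>2 ^ j\<close> is doubled to match
    the weight of that level.\<close>
  also have "\<dots> \<le> B 0 + (\<Sum>j<n. 2 ^ Suc j * B (Suc j))"
  proof (intro add_mono sum_mono)
    show "norm (a 0) \<le> B 0" by (rule tail_majorant_norm) simp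
    fix j
    have "(\<Sum>k\<in>{2 ^ j..<2 ^ Suc j}. norm (a (s * int k))) \<le> (\<Sum>k\<in>{2 ^ j..<2 ^ Suc j::nat}. B (Suc j))"
    proof (rule sum_mono)
      fix k :: nat assume "k \<in> {2 ^ j..<2 ^ Suc j}"
      then have "int (2 ^ Suc j div 2) \<le> int k" by (simp only: of_nat_le_iff) simp
      then show "norm (a (s * int k)) \<le> B (Suc j)"
        using s by (intro tail_majorant_norm) (auto simp: abs_mult)
    qed
    also have "\<dots> \<le> 2 ^ Suc j * B (Suc j)"
      using tail_majorant_nonneg[of "Suc j"] by simp
    finally show "(\<Sum>k\<in>{2 ^ j..<2 ^ Suc j}. norm (a (s * int k))) \<le> 2 ^ Suc j * B (Suc j)" .
  qed
  also have "\<dots> = (\<Sum>j\<le>n. 2 ^ j * B j)"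
    unfolding lessThan_Suc_atMost[symmetric] sum.lessThan_Suc_shift by simp
  finally show ?thesis .
qed

text \<open>The sum is cut at \<open>2 ^ n\<close>, about the inverse of the modulus of x. Below the
  cut the moduli are added, above it Abel summation applies; 4 = 1 + 3.\<close>

lemma side_sum_bound:
  assumes s: "s = 1 \<or> s = (-1::int)" and x: "x \<in> shell n"
  shows "norm (\<Sum>k<N. a (s * int k) * cis (of_int s * x) ^ k) \<le> 4 * (\<Sum>j\<le>n. 2 ^ j * B j)"
proof -
  let ?t = "\<lambda>k. a (s * int k) * cis (of_int s * x) ^ k"
  let ?H = "\<Sum>j\<le>n. 2 ^ j * B j"
  have H0: "0 \<le> ?H" by (intro sum_nonneg) (simp add: tail_majorant_nonneg)
  have head: "norm (sum ?t {..<m}) \<le> ?H" if "m \<le> 2 ^ n" for m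
  proof -
    have "norm (sum ?t {..<m}) \<le> (\<Sum>k<m. norm (a (s * int k)))"
      by (intro sum_norm_le) (simp add: norm_mult norm_power)
    also have "\<dots> \<le> (\<Sum>k<2 ^ n. norm (a (s * int k)))"
      using that by (intro sum_mono2) auto
    also have "\<dots> \<le> ?H" by (rule side_head_bound[OF s])
    finally show ?thesis .
  qed
  show ?thesis
  proof (cases "N \<le> 2 ^ n")
    case True
    then show ?thesis using head[of N] H0 by linarith
  next
    case False
    then have "sum ?t {..<N} = sum ?t {..<2 ^ n} + sum ?t {2 ^ n..<N}"
      unfolding lessThan_atLeast0 by (intro sum.atLeastLessThan_concat[symmetric]) auto
    then have "norm (sum ?t {..<N}) \<le> norm (sum ?t {..<2 ^ n}) + norm (sum ?t {2 ^ n..<N})"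
      by (simp only: norm_triangle_ineq)
    also have "norm (sum ?t {2 ^ n..<N}) \<le> 3 * 2 ^ n * B (Suc n)"
      by (rule side_tail_bound[OF s x]) simp
    also have "\<dots> \<le> 3 * (2 ^ n * B n)"
      using B by (simp add: tail_majorant_def)
    also have "2 ^ n * B n \<le> ?H"
      using member_le_sum[of n "{..n}" "\<lambda>j. 2 ^ j * B j"] by (simp add: tail_majorant_nonneg)
    finally show ?thesis using head[of "2 ^ n"] by simp
  qed
qed

lemma side_summable:
  assumes s: "s = 1 \<or> s = (-1::int)" and x: "x \<in> shell n" and B0: "B \<longlonglongrightarrow> 0"
  shows "summable (\<lambda>k. a (s * int k) * cis (of_int s * x) ^ k)"
  unfolding summable_Cauchy
proof (intro allI impI)
  fix e :: real assume e: "0 < e"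
  have "(\<lambda>i. 3 * 2 ^ n * B i) \<longlonglongrightarrow> 3 * 2 ^ n * 0" by (intro tendsto_mult tendsto_const B0)
  then have "eventually (\<lambda>i. 3 * 2 ^ n * B i < e) sequentially"
    using e by (intro order_tendstoD(2)) auto
  then obtain i where i: "3 * 2 ^ n * B i < e"
    using eventually_happens'[OF sequentially_bot] by blast
  show "\<exists>N. \<forall>m\<ge>N. \<forall>n. norm (\<Sum>k\<in>{m..<n}. a (s * int k) * cis (of_int s * x) ^ k) < e"
  proof (intro exI allI impI)
    fix m N :: nat assume "2 ^ i div 2 \<le> m"
    from side_tail_bound[OF s x this, of N] i
    show "norm (\<Sum>k\<in>{m..<N}. a (s * int k) * cis (of_int s * x) ^ k) < e" by simp
  qed
qed

lemma partial_sum_eq: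
  "partial_sum a N x = (\<Sum>k<Suc N. a (1 * int k) * cis (of_int 1 * x) ^ k)
     + (\<Sum>k<Suc N. a (-1 * int k) * cis (of_int (-1) * x) ^ k) - a 0"
proof (induction N)
  case 0
  have "{- int (Suc 0)<..<int (Suc 0)} = {0}" by auto
  then show ?case by (simp add: partial_sum_def)
next
  case (Suc N)
  have "{- int (Suc (Suc N))<..<int (Suc (Suc N))} =
      insert (int (Suc N)) (insert (- int (Suc N)) {- int (Suc N)<..<int (Suc N)})"
    by auto
  then have "partial_sum a (Suc N) x = a (int (Suc N)) * cis (of_int (int (Suc N)) * x) +
      (a (- int (Suc N)) * cis (of_int (- int (Suc N)) * x) + partial_sum a N x)"
    unfolding partial_sum_def by (simp del: of_nat_Suc)
  moreover have "cis (of_int (int (Suc N)) * x) = cis (of_int 1 * x) ^ Suc N"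
    "cis (of_int (- int (Suc N)) * x) = cis (of_int (-1) * x) ^ Suc N"
    unfolding Complex.DeMoivre by (simp_all add: algebra_simps)
  ultimately have "partial_sum a (Suc N) x = a (1 * int (Suc N)) * cis (of_int 1 * x) ^ Suc N +
      (a (-1 * int (Suc N)) * cis (of_int (-1) * x) ^ Suc N + partial_sum a N x)"
    by (simp only: mult_1 mult_minus1)
  then show ?case
    unfolding Suc.IH sum.lessThan_Suc[of _ "Suc N"] by (simp only: add_diff_eq ac_simps)
qed

text \<open>9 = 4 + 4 + 1: the two half-lines, and the coefficient \<open>a 0\<close>, which both of
  them contain and which is subtracted once.\<close>

lemma partial_sum_bound:
  assumes x: "x \<in> shell n"
  shows "norm (partial_sum a N x) \<le> 9 * (\<Sum>j\<le>n. 2 ^ j * B j)"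
proof -
  have "norm (a 0) \<le> B 0" by (rule tail_majorant_norm) simp
  also have "B 0 \<le> (\<Sum>j\<le>n. 2 ^ j * B j)"
    using member_le_sum[of 0 "{..n}" "\<lambda>j. 2 ^ j * B j"] by (simp add: tail_majorant_nonneg)
  finally have "norm (a 0) \<le> (\<Sum>j\<le>n. 2 ^ j * B j)" .
  moreover have "norm (partial_sum a N x) \<le> norm (\<Sum>k<Suc N. a (1 * int k) * cis (of_int 1 * x) ^ k)
     + norm (\<Sum>k<Suc N. a (-1 * int k) * cis (of_int (-1) * x) ^ k) + norm (a 0)"
    unfolding partial_sum_eq by (meson add_right_mono norm_triangle_ineq norm_triangle_ineq4 order_trans)
  ultimately show ?thesis
    using side_sum_bound[OF _ x, of 1 "Suc N"] side_sum_bound[OF _ x, of "-1" "Suc N"] by linarith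
qed

lemma partial_sum_convergent:
  assumes x: "x \<in> shell n" and B0: "B \<longlonglongrightarrow> 0"
  shows "convergent (\<lambda>N. partial_sum a N x)"
proof -
  have "convergent (\<lambda>N. \<Sum>k<N. a (s * int k) * cis (of_int s * x) ^ k)" if "s = 1 \<or> s = -1" for s
    using side_summable[OF that x B0] by (simp only: summable_iff_convergent)
  then have conv: "convergent (\<lambda>N. \<Sum>k<Suc N. a (s * int k) * cis (of_int s * x) ^ k)" if "s = 1 \<or> s = -1" for s
    using that convergent_Suc_iff[of "\<lambda>N. \<Sum>k<N. a (s * int k) * cis (of_int s * x) ^ k"] by blast
  then show ?thesis
    unfolding partial_sum_eq by (intro convergent_diff convergent_add convergent_const conv) simp_all
qed

end

section \<open>Orthogonality and the limit of the partial sums\<close>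

lemma integral_cis:
  "(LINT x:circ|lborel. cis (of_int m * x)) = (if m = 0 then complex_of_real (2 * pi) else 0)"
proof (cases "m = 0")
  case True
  then show ?thesis
    using set_integral_const[of circ lborel "1::complex"] by (simp add: scaleR_conv_of_real)
next
  case False
  define F where "F x = cis (of_int m * x) / (\<i> * of_int m)" for x
  have "(LINT x:circ|lborel. cis (of_int m * x)) = F pi - F (- pi)"
    unfolding set_lebesgue_integral_def
  proof (rule integral_FTC_atLeastAtMost)
    show "(F has_vector_derivative cis (of_int m * x)) (at x within {- pi..pi})" for x
    proof -
      have "((\<lambda>x. exp (\<i> * of_int m * of_real x) / (\<i> * of_int m)) has_vector_derivative
          exp (\<i> * of_int m * of_real x)) (at x within {- pi..pi})"
        using False by (auto intro!: derivative_eq_intros has_vector_derivative_real_field)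
      then show ?thesis by (simp add: F_def[abs_def] cis_conv_exp mult_ac)
    qed
    show "continuous_on {- pi..pi} (\<lambda>x. cis (of_int m * x))" by (intro continuous_intros)
  qed simp
  also have "F pi = F (- pi)"
  proof -
    have "cis (of_int m * pi) = cis (- (of_int m * pi))"
      by (simp add: complex_eq_iff mult.commute[of _ pi])
    then show ?thesis by (simp add: F_def)
  qed
  finally show ?thesis using False by simp
qed

lemma partial_sum_coeff:
  assumes "nat \<bar>l\<bar> \<le> N"
  shows "(LINT x:circ|lborel. partial_sum a N x * cis (- (of_int l * x))) = a l * complex_of_real (2 * pi)"
proof -
  let ?A = "{- int (Suc N)<..<int (Suc N)}"
  have int: "set_integrable lborel circ (\<lambda>x. a k * cis (of_int (k - l) * x))" for k
    by (intro borel_integrable_atLeastAtMost' continuous_intros)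
  have "partial_sum a N x * cis (- (of_int l * x)) = (\<Sum>k\<in>?A. a k * cis (of_int (k - l) * x))" for x
    unfolding partial_sum_def sum_distrib_right by (intro sum.cong) (simp_all add: mult.assoc cis_mult algebra_simps)
  then have "(LINT x:circ|lborel. partial_sum a N x * cis (- (of_int l * x))) =
      (LINT x:circ|lborel. \<Sum>k\<in>?A. a k * cis (of_int (k - l) * x))"
    by (simp only:)
  also have "\<dots> = (\<Sum>k\<in>?A. LINT x:circ|lborel. a k * cis (of_int (k - l) * x))"
    unfolding set_lebesgue_integral_def scaleR_sum_right
    by (rule Bochner_Integration.integral_sum) (rule int[unfolded set_integrable_def])
  also have "\<dots> = (\<Sum>k\<in>?A. if k = l then a k * complex_of_real (2 * pi) else 0)"
    by (intro sum.cong refl) (simp add: integral_cis del: of_int_diff)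
  also have "\<dots> = a l * complex_of_real (2 * pi)"
    using assms by (subst sum.delta) (auto simp: abs_less_iff)
  finally show ?thesis .
qed

text \<open>At most one term is nonzero at each point; the series form makes termwise integration
  available.\<close>

definition shell_step :: "(nat \<Rightarrow> real) \<Rightarrow> real \<Rightarrow> real" where
  "shell_step h x = (\<Sum>n. indicator (shell n) x * h n)"

lemma shell_step_sums:
  assumes "x \<in> shell n"
  shows "(\<lambda>m. indicator (shell m) x * h m) sums (h n :: real)"
proof -
  have "(\<lambda>m. if m = n then h m else 0) sums h n" by (rule sums_single)
  moreover have "(if m = n then h m else 0) = indicator (shell m) x * h m" for m
    using assms shell_disjoint[of m n] by (auto simp: indicator_def)
  ultimately show ?thesis by simp
qed

lemma shell_step_eq: "x \<in> shell n \<Longrightarrow> shell_step h x = h n"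
  unfolding shell_step_def using shell_step_sums by (rule sums_unique[symmetric])

lemma shell_step_integral:
  assumes h: "\<And>n. 0 \<le> h n" and s: "summable (\<lambda>n. h n / 2 ^ n)"
  shows "integrable lborel (shell_step h)"
    and "(LINT x|lborel. shell_step h x) = pi * (\<Sum>n. h n / 2 ^ n)"
proof -
  have i1: "integrable lborel (\<lambda>x. indicator (shell n) x * h n)" for n
    using integrable_real_indicator[of "shell n" lborel] by (simp add: emeasure_shell)
  have v: "(LINT x|lborel. indicator (shell n) x * h n) = pi * (h n / 2 ^ n)" for n
    by (simp add: measure_def emeasure_shell)
  have v': "(LINT x|lborel. norm (indicator (shell n) x * h n)) = pi * (h n / 2 ^ n)" for n
    using v[of n] h[of n] by (simp add: abs_mult)
  have sm: "summable (\<lambda>n. norm (indicator (shell n) x * h n))" for x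
  proof (cases "\<exists>n. x \<in> shell n")
    case True
    then obtain n where "x \<in> shell n" by blast
    from sums_summable[OF shell_step_sums[OF this]] show ?thesis
      using h by (simp add: abs_mult)
  qed simp
  have A1: "AE x in lborel. summable (\<lambda>n. norm (indicator (shell n) x * h n))"
    using sm by simp
  have A2: "summable (\<lambda>n. LINT x|lborel. norm (indicator (shell n) x * h n))"
    unfolding v' by (rule summable_mult[OF s])
  show "integrable lborel (shell_step h)"
    unfolding shell_step_def by (rule integrable_suminf[OF i1 A1 A2])
  show "(LINT x|lborel. shell_step h x) = pi * (\<Sum>n. h n / 2 ^ n)"
    unfolding shell_step_def by (subst integral_suminf[OF i1 A1 A2]) (simp only: v suminf_mult[OF s])
qed

lemma Lp_le_tail_majorant:
  assumes p: "1 < p"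
  shows "\<exists>K>0. \<forall>f B. set_integrable lborel circ f \<longrightarrow> tail_majorant (fourier_coeff f) B \<longrightarrow>
     summable (\<lambda>n. (wt p n * B n) powr p) \<longrightarrow>
     set_integrable lborel circ (\<lambda>x. norm (f x) powr p) \<and>
     (LINT x:circ|lborel. norm (f x) powr p) \<le> K * (\<Sum>n. (wt p n * B n) powr p)"
proof -
  have d: "0 < decay p" and p0: "0 < p" using p by (auto intro: decay_pos)
  obtain K where K: "0 < K" and sch: "\<forall>b. (\<forall>m. 0 \<le> b m) \<longrightarrow> summable (\<lambda>m. b m powr p) \<longrightarrow>
       summable (\<lambda>n. (\<Sum>m. kern (decay p) n m * b m) powr p) \<and>
       (\<Sum>n. (\<Sum>m. kern (decay p) n m * b m) powr p) \<le> K * (\<Sum>m. b m powr p)"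
    using kern_schur[OF d p0] by blast
  have main: "set_integrable lborel circ (\<lambda>x. norm (f x) powr p) \<and>
     (LINT x:circ|lborel. norm (f x) powr p) \<le> (pi * (9 powr p * K)) * (\<Sum>n. (wt p n * B n) powr p)"
    if f: "set_integrable lborel circ f" and B: "tail_majorant (fourier_coeff f) B"
      and sB: "summable (\<lambda>n. (wt p n * B n) powr p)" for f B
  proof -
    let ?a = "fourier_coeff f"
    let ?S = "partial_sum ?a"
    note B0 = tail_majorant_nonneg[OF B]
    have Blim: "B \<longlonglongrightarrow> 0"
    proof -
      have "(\<lambda>n. ((wt p n * B n) powr p) powr (1 / p)) \<longlonglongrightarrow> 0 powr (1 / p)"
        using p by (intro tendsto_powr' summable_LIMSEQ_zero[OF sB] tendsto_const) auto
      then have lim: "(\<lambda>n. wt p n * B n) \<longlonglongrightarrow> 0"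
        using p B0 by (simp add: powr_powr)
      show ?thesis
      proof (rule tendsto_sandwich[OF _ _ tendsto_const lim])
        show "eventually (\<lambda>n. 0 \<le> B n) sequentially" using B0 by simp
        show "eventually (\<lambda>n. B n \<le> wt p n * B n) sequentially"
          using mult_right_mono[OF wt_ge_1[OF p] B0] by simp
      qed
    qed
    define H where "H n = 9 * (\<Sum>j\<le>n. 2 ^ j * B j)" for n
    have H0: "0 \<le> H n" for n unfolding H_def using B0 by (intro mult_nonneg_nonneg sum_nonneg) auto
    have "summable (\<lambda>n. (9 * (wt p n * ((\<Sum>j\<le>n. 2 ^ j * B j) / 2 ^ n))) powr p) \<and>
       (\<Sum>n. (9 * (wt p n * ((\<Sum>j\<le>n. 2 ^ j * B j) / 2 ^ n))) powr p) \<le> 9 powr p * (K * (\<Sum>n. (wt p n * B n) powr p))"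
    proof (rule suminf_powr_le[OF p0, where y = "\<lambda>n. \<Sum>m. kern (decay p) n m * (wt p m * B m)"])
      show "wt p n * ((\<Sum>j\<le>n. 2 ^ j * B j) / 2 ^ n) \<le> (\<Sum>m. kern (decay p) n m * (wt p m * B m))" for n
        by (rule dyadic_average_kern[OF p B0 sB])
      show "0 \<le> wt p n * ((\<Sum>j\<le>n. 2 ^ j * B j) / 2 ^ n)" for n
        using B0 by (simp add: sum_nonneg)
    qed (use sch[rule_format, of "\<lambda>m. wt p m * B m"] sB B0 in auto)
    \<comment> \<open>The weight is matched to the measure of the shell:
      \<open>wt p n powr p / (2 ^ n) powr p = 1 / 2 ^ n\<close>, so up to the factor pi the series
      is the integral of the step function with values \<open>H n powr p\<close>.\<close>
    moreover have "(9 * (wt p n * ((\<Sum>j\<le>n. 2 ^ j * B j) / 2 ^ n))) powr p = H n powr p / 2 ^ n" for n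
    proof -
      have "(9 * (wt p n * ((\<Sum>j\<le>n. 2 ^ j * B j) / 2 ^ n))) powr p = (H n * (wt p n / 2 ^ n)) powr p"
        by (simp add: H_def mult_ac)
      also have "\<dots> = H n powr p * (wt p n powr p / (2 ^ n) powr p)"
        by (simp add: powr_mult powr_divide)
      also have "wt p n powr p / (2 ^ n) powr p = 1 / 2 ^ n"
        using p by (simp add: wt_powr powr_realpow[symmetric] powr_powr algebra_simps flip: powr_diff powr_minus_divide)
      finally show ?thesis by simp
    qed
    ultimately have sHp: "summable (\<lambda>n. H n powr p / 2 ^ n)"
      and leH: "(\<Sum>n. H n powr p / 2 ^ n) \<le> 9 powr p * (K * (\<Sum>n. (wt p n * B n) powr p))"
      by simp_all
    \<comment> \<open>\<open>le_add_powr\<close> at level 1 gives \<open>H <= 1 + H powr p\<close>,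
      so the majorant of the partial sums is itself integrable, as dominated convergence
      requires.\<close>
    have sH: "summable (\<lambda>n. H n / 2 ^ n)"
    proof (rule summable_comparison_test')
      show "summable (\<lambda>n. (1 / 2) ^ n + H n powr p / 2 ^ n)"
        by (intro summable_add summable_geometric sHp) simp
      fix n
      have "H n / 2 ^ n \<le> (1 + H n powr p) / 2 ^ n"
        using le_add_powr[OF p H0, of 1 n] by (intro divide_right_mono) auto
      then show "norm (H n / 2 ^ n) \<le> (1 / 2) ^ n + H n powr p / 2 ^ n"
        using H0[of n] by (simp add: add_divide_distrib power_divide)
    qed
    have in_shell: "\<exists>n. x \<in> shell n" if "x \<in> circ" "x \<noteq> 0" for x
      using shell_Union that by blast
    have Sm [measurable]: "?S N \<in> borel_measurable borel" for N
      unfolding partial_sum_def[abs_def] by measurable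
    \<comment> \<open>Convergence is established on the shells only. At 0 the value of
      \<open>lim\<close> is unspecified, which the integrals over the circle do not see.\<close>
    define g where "g x = lim (\<lambda>N. ?S N x)" for x
    have gm [measurable]: "g \<in> borel_measurable borel"
      unfolding g_def[abs_def] by measurable
    have Slim: "(\<lambda>N. ?S N x) \<longlonglongrightarrow> g x" if "x \<in> shell n" for x n
      unfolding g_def using partial_sum_convergent[OF B that Blim] by (simp add: convergent_LIMSEQ_iff)
    have gH: "norm (g x) \<le> H n" if "x \<in> shell n" for x n
      using Lim_bounded[OF tendsto_norm[OF Slim[OF that]], of 0 "H n"] partial_sum_bound[OF B that]
      by (simp add: H_def)
    note stepI = shell_step_integral(1)[OF H0 sH]
    have ne0: "AE x in lborel. x \<noteq> (0::real)" by (rule AE_lborel_singleton)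
    have gint: "set_integrable lborel circ g"
      unfolding set_integrable_def
    proof (rule Bochner_Integration.integrable_bound[OF stepI])
      show "AE x in lborel. norm (indicator circ x *\<^sub>R g x) \<le> norm (shell_step H x)"
        using ne0
      proof eventually_elim
        fix x :: real assume "x \<noteq> 0"
        show "norm (indicator circ x *\<^sub>R g x) \<le> norm (shell_step H x)"
        proof (cases "x \<in> circ")
          case True
          then obtain n where "x \<in> shell n" using in_shell \<open>x \<noteq> 0\<close> by blast
          then show ?thesis using gH[of x n] H0[of n] True by (simp add: shell_step_eq)
        qed simp
      qed
    qed measurable
    have "null_coeffs (\<lambda>x. f x - g x)"
      unfolding null_coeffs_def
    proof (intro conjI allI)
      show "set_integrable lborel circ (\<lambda>x. f x - g x)" using f gint by (rule set_integral_diff)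
      fix l :: int
      let ?e = "\<lambda>x. cis (- (of_int l * x))"
      have "(\<lambda>N. LINT x:circ|lborel. ?S N x * ?e x) \<longlonglongrightarrow> (LINT x:circ|lborel. g x * ?e x)"
        unfolding set_lebesgue_integral_def
      proof (rule integral_dominated_convergence[OF _ _ stepI])
        show "AE x in lborel. (\<lambda>N. indicator circ x *\<^sub>R (?S N x * ?e x)) \<longlonglongrightarrow> indicator circ x *\<^sub>R (g x * ?e x)"
          using ne0
        proof eventually_elim
          fix x :: real assume "x \<noteq> 0"
          show "(\<lambda>N. indicator circ x *\<^sub>R (?S N x * ?e x)) \<longlonglongrightarrow> indicator circ x *\<^sub>R (g x * ?e x)"
          proof (cases "x \<in> circ")
            case True
            then obtain n where "x \<in> shell n" using in_shell \<open>x \<noteq> 0\<close> by blast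
            then show ?thesis by (intro tendsto_intros Slim)
          qed simp
        qed
        show "AE x in lborel. norm (indicator circ x *\<^sub>R (?S N x * ?e x)) \<le> shell_step H x" for N
          using ne0
        proof eventually_elim
          fix x :: real assume "x \<noteq> 0"
          show "norm (indicator circ x *\<^sub>R (?S N x * ?e x)) \<le> shell_step H x"
          proof (cases "x \<in> circ")
            case True
            then obtain n where "x \<in> shell n" using in_shell \<open>x \<noteq> 0\<close> by blast
            then show ?thesis using partial_sum_bound[OF B, of x n N] True by (simp add: shell_step_eq norm_mult H_def)
          next
            case False
            then have "x \<notin> shell n" for n using shell_subset by blast
            then show ?thesis using False by (simp add: shell_step_def)
          qed
        qed
      qed measurable
      moreover have "eventually (\<lambda>N. (LINT x:circ|lborel. ?S N x * ?e x) = ?a l * complex_of_real (2 * pi)) sequentially"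
        using eventually_ge_at_top[of "nat \<bar>l\<bar>"] by eventually_elim (rule partial_sum_coeff)
      then have "(\<lambda>N. LINT x:circ|lborel. ?S N x * ?e x) \<longlonglongrightarrow> ?a l * complex_of_real (2 * pi)"
        by (rule tendsto_eventually)
      ultimately have "(LINT x:circ|lborel. g x * ?e x) = ?a l * complex_of_real (2 * pi)"
        by (rule LIMSEQ_unique)
      also have "\<dots> = (LINT x:circ|lborel. f x * ?e x)"
        by (simp add: fourier_coeff_cis)
      finally have eq: "(LINT x:circ|lborel. g x * ?e x) = (LINT x:circ|lborel. f x * ?e x)" .
      have "(LINT x:circ|lborel. f x * ?e x - g x * ?e x) = 0"
        using set_integral_diff(2)[OF set_integrable_mult_cis[OF f, of "- of_int l"] set_integrable_mult_cis[OF gint, of "- of_int l"]] eq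
        by simp
      then show "(LINT x:circ|lborel. (f x - g x) * ?e x) = 0"
        by (simp only: left_diff_distrib)
    qed
    from null_coeffs_AE[OF this] have fg: "AE x in lborel. x \<in> circ \<longrightarrow> f x - g x = 0" .
    have sHp0: "0 \<le> H n powr p" for n by simp
    note stepP = shell_step_integral[OF sHp0 sHp]
    have dom: "AE x in lborel. indicator circ x *\<^sub>R (norm (f x) powr p) \<le> shell_step (\<lambda>n. H n powr p) x"
      using ne0 fg
    proof eventually_elim
      fix x :: real assume x: "x \<noteq> 0" "x \<in> circ \<longrightarrow> f x - g x = 0"
      show "indicator circ x *\<^sub>R (norm (f x) powr p) \<le> shell_step (\<lambda>n. H n powr p) x"
      proof (cases "x \<in> circ")
        case True
        then obtain n where n: "x \<in> shell n" using in_shell x by blast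
        then show ?thesis using gH[OF n] x True p by (simp add: shell_step_eq powr_mono2)
      next
        case False
        then have "x \<notin> shell n" for n using shell_subset by blast
        then show ?thesis using False by (simp add: shell_step_def)
      qed
    qed
    have "(\<lambda>x. indicator circ x *\<^sub>R f x) \<in> borel_measurable lborel"
      using f by (auto simp: set_integrable_def dest: borel_measurable_integrable)
    then have "(\<lambda>x. norm (indicator circ x *\<^sub>R f x) powr p) \<in> borel_measurable lborel"
      by measurable
    moreover have "norm (indicator circ x *\<^sub>R f x) powr p = indicator circ x *\<^sub>R (norm (f x) powr p)" for x
      using p by (simp add: indicator_def)
    ultimately have fm: "(\<lambda>x. indicator circ x *\<^sub>R (norm (f x) powr p)) \<in> borel_measurable lborel"
      by simp
    have int: "integrable lborel (\<lambda>x. indicator circ x *\<^sub>R (norm (f x) powr p))"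
    proof (rule Bochner_Integration.integrable_bound[OF stepP(1) fm])
      show "AE x in lborel. norm (indicator circ x *\<^sub>R (norm (f x) powr p)) \<le> norm (shell_step (\<lambda>n. H n powr p) x)"
        using dom by eventually_elim (simp add: order_trans[OF _ abs_ge_self])
    qed
    have "(LINT x:circ|lborel. norm (f x) powr p) \<le> pi * (\<Sum>n. H n powr p / 2 ^ n)"
      unfolding set_lebesgue_integral_def stepP(2)[symmetric] by (rule integral_mono_AE[OF int stepP(1) dom])
    also have "\<dots> \<le> pi * (9 powr p * (K * (\<Sum>n. (wt p n * B n) powr p)))"
      by (intro mult_left_mono leH) simp
    finally show ?thesis using int by (simp add: set_integrable_def mult.assoc)
  qed
  have "0 < pi * (9 powr p * K)" using K by simp
  then show ?thesis using main by blast
qed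

section \<open>Comparison of the two norms\<close>

text \<open>For nonnegative terms unordered and ordinary summability agree. The splitting separates
  the even ranks of the rearrangement, at indices k >= 0, from the odd ones, at k < 0.\<close>

lemma int_sum_nonneg:
  fixes g :: "int \<Rightarrow> real"
  assumes g: "\<And>k. 0 \<le> g k"
  shows "g summable_on UNIV \<longleftrightarrow> summable (\<lambda>n. g (int n)) \<and> summable (\<lambda>n. g (- int (Suc n)))" (is ?A)
    and "g summable_on UNIV \<Longrightarrow> infsum g UNIV = (\<Sum>n. g (int n)) + (\<Sum>n. g (- int (Suc n)))"
proof -
  let ?neg = "\<lambda>n. - int (Suc n)"
  have U: "UNIV = range int \<union> range ?neg"
  proof -
    have "k \<in> range int \<union> range ?neg" for k :: int
      by (cases k) auto
    then show ?thesis by blast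
  qed
  have disj: "range int \<inter> range ?neg = {}" by auto
  have inj: "inj int" "inj ?neg" by (auto simp: inj_on_def)
  have pos: "g summable_on range int \<longleftrightarrow> summable (\<lambda>n. g (int n))"
    using summable_on_reindex[OF inj(1), of g] summable_on_UNIV_nonneg_real_iff[of "g \<circ> int"] g by (simp add: o_def)
  have neg: "g summable_on range ?neg \<longleftrightarrow> summable (\<lambda>n. g (?neg n))"
    using summable_on_reindex[OF inj(2), of g] summable_on_UNIV_nonneg_real_iff[of "g \<circ> ?neg"] g by (simp add: o_def)
  have both: "g summable_on UNIV \<longleftrightarrow> g summable_on range int \<and> g summable_on range ?neg"
  proof
    assume "g summable_on UNIV"
    then show "g summable_on range int \<and> g summable_on range ?neg"
      using summable_on_subset_banach[OF _ subset_UNIV] by blast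
  next
    assume "g summable_on range int \<and> g summable_on range ?neg"
    then show "g summable_on UNIV"
      unfolding U by (intro summable_on_Un_disjoint disj) blast+
  qed
  show ?A using both pos neg by simp
  assume s: "g summable_on UNIV"
  then have s1: "g summable_on range int" and s2: "g summable_on range ?neg" using both by auto
  have inf: "infsum h UNIV = suminf h" if "summable h" "\<And>n. 0 \<le> h n" for h :: "nat \<Rightarrow> real"
    using infsumI[OF sums_nonneg_imp_has_sum[OF summable_sums[OF that(1)] that(2)]] .
  have "infsum g UNIV = infsum g (range int) + infsum g (range ?neg)"
    unfolding U by (rule infsum_Un_disjoint[OF s1 s2 disj])
  also have "infsum g (range int) = (\<Sum>n. g (int n))"
    using infsum_reindex[OF inj(1), of g] inf[of "\<lambda>n. g (int n)"] s1 pos g by (simp add: o_def)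
  also have "infsum g (range ?neg) = (\<Sum>n. g (?neg n))"
    using infsum_reindex[OF inj(2), of g] inf[of "\<lambda>n. g (?neg n)"] s2 neg g by (simp add: o_def)
  finally show "infsum g UNIV = (\<Sum>n. g (int n)) + (\<Sum>n. g (?neg n))" .
qed

definition J_term :: "real \<Rightarrow> (int \<Rightarrow> complex) \<Rightarrow> int \<Rightarrow> real" where
  "J_term p a k = (real_of_int \<bar>k\<bar> + 1) powr (p - 2) * sym_rearr a k powr p"

lemma J_term_nonneg: "0 \<le> J_term p a k"
  by (simp add: J_term_def)

lemma J_term_int: "J_term p a (int n) = (real n + 1) powr (p - 2) * even_rearr a n powr p"
  by (simp add: J_term_def sym_rearr_def even_rearr_def nat_mult_distrib)

lemma J_term_neg: "J_term p a (- int (Suc n)) = (real (Suc n) + 1) powr (p - 2) * decr_rearr a (2 * n + 1) powr p"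
proof -
  have "nat (2 * \<bar>- int (Suc n)\<bar> - 1) = 2 * n + 1" by simp
  then show ?thesis unfolding J_term_def sym_rearr_def by simp
qed

text \<open>Since 2n >= n and 2n + 1 >= n + 1, both halves of the symmetric sum are dominated by the
  single series \<open>?u\<close>, the negative half with its index shifted by one; hence the
  leading factor 2.\<close>

lemma J_le_tail_majorant:
  assumes p: "1 < p" and bd: "\<And>k. norm (a k) \<le> M" and B: "tail_majorant a B"
    and sB: "summable (\<lambda>n. (wt p n * B n) powr p)"
  shows "J_term p a summable_on UNIV"
    and "infsum (J_term p a) UNIV \<le> 2 * 2 powr \<bar>p - 2\<bar> * (\<Sum>n. (wt p n * B n) powr p)"
proof -
  let ?d = "decr_rearr a"
  let ?u = "\<lambda>k. (real k + 1) powr (p - 2) * ?d k powr p"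
  note dec = decr_rearr_antimono[of a M, OF bd]
  note d0 = decr_rearr_nonneg[of a M, OF bd]
  have p0: "0 < p" using p by simp
  have "summable (\<lambda>n. (1 * (wt p n * ?d (2 ^ n - 1))) powr p) \<and>
     (\<Sum>n. (1 * (wt p n * ?d (2 ^ n - 1))) powr p) \<le> 1 powr p * (\<Sum>n. (wt p n * B n) powr p)"
    by (rule suminf_powr_le[OF p0, where y = "\<lambda>n. wt p n * B n"])
      (use sB d0 decr_rearr_tail_majorant[OF B] in \<open>auto intro: mult_left_mono\<close>)
  then have s1: "summable (\<lambda>n. (wt p n * ?d (2 ^ n - 1)) powr p)"
    and l1: "(\<Sum>n. (wt p n * ?d (2 ^ n - 1)) powr p) \<le> (\<Sum>n. (wt p n * B n) powr p)" by auto
  note cond = condensation_upper[OF p dec d0 s1]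
  have l2: "suminf ?u \<le> 2 powr \<bar>p - 2\<bar> * (\<Sum>n. (wt p n * B n) powr p)"
    by (rule order_trans[OF cond(2) mult_left_mono[OF l1]]) simp
  have le1: "J_term p a (int n) \<le> ?u n" for n
    unfolding J_term_int even_rearr_def using p d0 by (intro mult_left_mono powr_mono2 antimonoD[OF dec]) auto
  have le2: "J_term p a (- int (Suc n)) \<le> ?u (Suc n)" for n
    unfolding J_term_neg using p d0 by (intro mult_left_mono powr_mono2 antimonoD[OF dec]) auto
  have su: "summable (\<lambda>n. ?u (Suc n))" using cond(1) by (subst summable_Suc_iff)
  have sp: "summable (\<lambda>n. J_term p a (int n))"
    by (rule summable_comparison_test'[OF cond(1)]) (use le1 J_term_nonneg in auto)
  have sn: "summable (\<lambda>n. J_term p a (- int (Suc n)))"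
    by (rule summable_comparison_test'[OF su]) (use le2 J_term_nonneg in \<open>simp del: of_nat_Suc\<close>)
  show sJ: "J_term p a summable_on UNIV"
    using sp sn int_sum_nonneg(1)[of "J_term p a"] J_term_nonneg by blast
  have "infsum (J_term p a) UNIV = (\<Sum>n. J_term p a (int n)) + (\<Sum>n. J_term p a (- int (Suc n)))"
    using int_sum_nonneg(2)[OF J_term_nonneg sJ] .
  also have "\<dots> \<le> suminf ?u + (\<Sum>n. ?u (Suc n))"
    by (intro add_mono suminf_le le1 le2 sp sn cond(1) su)
  also have "(\<Sum>n. ?u (Suc n)) \<le> suminf ?u"
    using suminf_split_head[OF cond(1)] by simp
  finally show "infsum (J_term p a) UNIV \<le> 2 * 2 powr \<bar>p - 2\<bar> * (\<Sum>n. (wt p n * B n) powr p)"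
    using l2 by simp
qed

text \<open>The half k >= 0 of the sum is condensed to dyadic ranks, and Schur's test passes to the
  Hardy averages that bound the interval averages. The factor \<open>2 powr p\<close> comes from the
  2 in \<open>avg_bound_rearr\<close>.\<close>

lemma avg_bound_J:
  assumes p: "1 < p"
  shows "\<exists>K>0. \<forall>a M. (\<forall>k. norm (a k) \<le> M) \<longrightarrow> J_term p a summable_on UNIV \<longrightarrow>
    (\<exists>R. avg_bound a R \<and> summable (\<lambda>n. (wt p n * R n) powr p) \<and>
      (\<Sum>n. (wt p n * R n) powr p) \<le> K * infsum (J_term p a) UNIV)"
proof -
  have d: "0 < decay p" and p0: "0 < p" using p by (auto intro: decay_pos)
  obtain K where K: "0 < K" and sch: "\<forall>b. (\<forall>m. 0 \<le> b m) \<longrightarrow> summable (\<lambda>m. b m powr p) \<longrightarrow>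
       summable (\<lambda>n. (\<Sum>m. kern (decay p) n m * b m) powr p) \<and>
       (\<Sum>n. (\<Sum>m. kern (decay p) n m * b m) powr p) \<le> K * (\<Sum>m. b m powr p)"
    using kern_schur[OF d p0] by blast
  have main: "\<exists>R. avg_bound a R \<and> summable (\<lambda>n. (wt p n * R n) powr p) \<and>
      (\<Sum>n. (wt p n * R n) powr p) \<le> (2 powr p * (K * (2 * 2 powr \<bar>p - 2\<bar>))) * infsum (J_term p a) UNIV"
    if bd: "\<forall>k. norm (a k) \<le> M" and sJ: "J_term p a summable_on UNIV" for a M
  proof -
    let ?e = "even_rearr a"
    let ?R = "\<lambda>n. 2 * ((\<Sum>i\<le>n. 2 ^ i * ?e (2 ^ i - 1)) / 2 ^ n)"
    note bd' = bd[rule_format]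
    have dec: "antimono ?e"
      using antimonoD[OF decr_rearr_antimono[of a M, OF bd']] by (intro antimonoI) (simp add: even_rearr_def)
    have e0: "0 \<le> ?e n" for n
      using decr_rearr_nonneg[of a M, OF bd'] by (simp add: even_rearr_def)
    note sums = int_sum_nonneg[of "J_term p a", OF J_term_nonneg]
    have sp: "summable (\<lambda>n. J_term p a (int n))" and sn: "summable (\<lambda>n. J_term p a (- int (Suc n)))"
      using sums(1) sJ by auto
    have lJ: "(\<Sum>n. J_term p a (int n)) \<le> infsum (J_term p a) UNIV"
      using sums(2)[OF sJ] suminf_nonneg[OF sn] J_term_nonneg by simp
    note cond = condensation_lower[OF p dec e0 sp[unfolded J_term_int]]
    have "(\<Sum>n. (wt p n * ?e (2 ^ n - 1)) powr p) \<le> 2 * 2 powr \<bar>p - 2\<bar> * infsum (J_term p a) UNIV"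
      by (rule order_trans[OF cond(2) mult_left_mono[OF lJ[unfolded J_term_int]]]) simp
    then have le: "K * (\<Sum>n. (wt p n * ?e (2 ^ n - 1)) powr p) \<le> K * (2 * 2 powr \<bar>p - 2\<bar> * infsum (J_term p a) UNIV)"
      using K by (intro mult_left_mono) auto
    have "summable (\<lambda>n. (2 * (wt p n * ((\<Sum>i\<le>n. 2 ^ i * ?e (2 ^ i - 1)) / 2 ^ n))) powr p) \<and>
       (\<Sum>n. (2 * (wt p n * ((\<Sum>i\<le>n. 2 ^ i * ?e (2 ^ i - 1)) / 2 ^ n))) powr p)
         \<le> 2 powr p * (K * (2 * 2 powr \<bar>p - 2\<bar> * infsum (J_term p a) UNIV))"
    proof (rule suminf_powr_le[OF p0, where y = "\<lambda>n. \<Sum>i. kern (decay p) n i * (wt p i * ?e (2 ^ i - 1))"])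
      show "wt p n * ((\<Sum>i\<le>n. 2 ^ i * ?e (2 ^ i - 1)) / 2 ^ n) \<le> (\<Sum>i. kern (decay p) n i * (wt p i * ?e (2 ^ i - 1)))" for n
        by (rule dyadic_average_kern[OF p e0 cond(1)])
      show "0 \<le> wt p n * ((\<Sum>i\<le>n. 2 ^ i * ?e (2 ^ i - 1)) / 2 ^ n)" for n
        using e0 by (simp add: sum_nonneg)
      have "summable (\<lambda>n. (\<Sum>i. kern (decay p) n i * (wt p i * ?e (2 ^ i - 1))) powr p) \<and>
         (\<Sum>n. (\<Sum>i. kern (decay p) n i * (wt p i * ?e (2 ^ i - 1))) powr p)
          \<le> K * (\<Sum>n. (wt p n * ?e (2 ^ n - 1)) powr p)"
        using cond(1) e0 by (intro sch[rule_format]) auto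
      then show "summable (\<lambda>n. (\<Sum>i. kern (decay p) n i * (wt p i * ?e (2 ^ i - 1))) powr p)"
        "(\<Sum>n. (\<Sum>i. kern (decay p) n i * (wt p i * ?e (2 ^ i - 1))) powr p)
          \<le> K * (2 * 2 powr \<bar>p - 2\<bar> * infsum (J_term p a) UNIV)"
        using le by auto
    qed simp
    moreover have "2 * (wt p n * ((\<Sum>i\<le>n. 2 ^ i * ?e (2 ^ i - 1)) / 2 ^ n)) = wt p n * ?R n" for n
      by simp
    ultimately have "summable (\<lambda>n. (wt p n * ?R n) powr p) \<and>
       (\<Sum>n. (wt p n * ?R n) powr p) \<le> 2 powr p * (K * (2 * 2 powr \<bar>p - 2\<bar> * infsum (J_term p a) UNIV))"
      by (simp only:)
    then show ?thesis
      using avg_bound_rearr[of a M, OF bd'] by (intro exI[of _ ?R]) (simp only: mult.assoc simp_thms)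
  qed
  have "0 < 2 powr p * (K * (2 * 2 powr \<bar>p - 2\<bar>))" using K by simp
  then show ?thesis using main by blast
qed

theorem theorem1:
  fixes p C :: real
  assumes "1 < p" and "0 < C"
  shows "\<exists>c1 c2. 0 < c1 \<and> c1 \<le> c2 \<and>
    (\<forall>f :: real \<Rightarrow> complex.
       set_integrable lborel {-pi..pi} f \<and> GM_star C (fourier_coeff f) \<longrightarrow>
         (Lp_finite p f \<longleftrightarrow> J_star_finite p f) \<and>
         (Lp_finite p f \<longrightarrow> c1 * J_star p f \<le> Lp_norm p f \<and> Lp_norm p f \<le> c2 * J_star p f))"
proof -
  obtain G where G: "0 < G" and gm: "\<forall>a R. GM_star C a \<longrightarrow> avg_bound a R \<longrightarrow>
      summable (\<lambda>n. (wt p n * R n) powr p) \<longrightarrow>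
      (\<exists>B. tail_majorant a B \<and> summable (\<lambda>n. (wt p n * B n) powr p) \<and>
        (\<Sum>n. (wt p n * B n) powr p) \<le> G * (\<Sum>n. (wt p n * R n) powr p))"
    using GM_star_tail_majorant[OF assms] by blast
  obtain K where K: "0 < K" and avgL: "\<forall>f. set_integrable lborel circ f \<longrightarrow>
    set_integrable lborel circ (\<lambda>x. norm (f x) powr p) \<longrightarrow>
    (\<exists>R. avg_bound (fourier_coeff f) R \<and> summable (\<lambda>n. (wt p n * R n) powr p) \<and>
      (\<Sum>n. (wt p n * R n) powr p) \<le> K * (LINT x:circ|lborel. norm (f x) powr p))"
    using avg_bound_Lp[OF assms(1)] by blast
  obtain K' where K': "0 < K'" and avgJ: "\<forall>a M. (\<forall>k. norm (a k) \<le> M) \<longrightarrow> J_term p a summable_on UNIV \<longrightarrow>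
    (\<exists>R. avg_bound a R \<and> summable (\<lambda>n. (wt p n * R n) powr p) \<and>
      (\<Sum>n. (wt p n * R n) powr p) \<le> K' * infsum (J_term p a) UNIV)"
    using avg_bound_J[OF assms(1)] by blast
  obtain L where L: "0 < L" and Lp: "\<forall>f B. set_integrable lborel circ f \<longrightarrow> tail_majorant (fourier_coeff f) B \<longrightarrow>
     summable (\<lambda>n. (wt p n * B n) powr p) \<longrightarrow>
     set_integrable lborel circ (\<lambda>x. norm (f x) powr p) \<and>
     (LINT x:circ|lborel. norm (f x) powr p) \<le> L * (\<Sum>n. (wt p n * B n) powr p)"
    using Lp_le_tail_majorant[OF assms(1)] by blast
  \<comment> \<open>\<open>D\<close> composes the chain from the Lp integral through averages
    (\<open>K\<close>) and tails (\<open>G\<close>) to the rearranged sum, \<open>E\<close> the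
    chain from that sum through averages (\<open>K'\<close>) and tails (\<open>G\<close>) to the
    integral (\<open>L\<close>).\<close>
  define D where "D = 2 * 2 powr \<bar>p - 2\<bar> * (G * K)"
  define E where "E = L * (G * K')"
  have D: "0 < D" and E: "0 < E" using G K K' L by (auto simp: D_def E_def)
  define c1 where "c1 = 1 / D powr (1 / p)"
  \<comment> \<open>The maximum secures \<open>c1 <= c2\<close> irrespective of whether some
    admissible f has a positive finite norm.\<close>
  define c2 where "c2 = max c1 (E powr (1 / p))"
  have main: "(Lp_finite p f \<longleftrightarrow> J_star_finite p f) \<and>
      (Lp_finite p f \<longrightarrow> c1 * J_star p f \<le> Lp_norm p f \<and> Lp_norm p f \<le> c2 * J_star p f)"
    if f: "set_integrable lborel {-pi..pi} f" and GM: "GM_star C (fourier_coeff f)" for f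
  proof -
    let ?a = "fourier_coeff f"
    define J where "J = infsum (J_term p ?a) UNIV"
    define N where "N = (LINT x:circ|lborel. norm (f x) powr p)"
    have bd: "norm (?a k) \<le> (LINT x:circ|lborel. norm (f x))" for k by (rule fourier_coeff_bounded[OF f])
    have J0: "0 \<le> J" unfolding J_def by (intro infsum_nonneg J_term_nonneg)
    have N0: "0 \<le> N" by (simp add: N_def set_lebesgue_integral_def integral_nonneg_AE)
    have Jfin: "J_star_finite p f \<longleftrightarrow> J_term p ?a summable_on UNIV"
      by (simp add: J_star_finite_def J_term_def[abs_def])
    have Jst: "J_star p f = J powr (1 / p)"
      by (simp add: J_star_def J_def J_term_def[abs_def])
    have Nst: "Lp_norm p f = N powr (1 / p)"
      by (simp add: Lp_norm_def N_def)
    have to_J: "J_term p ?a summable_on UNIV \<and> J \<le> D * N" if Lf: "Lp_finite p f"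
    proof -
      obtain R where R: "avg_bound ?a R" "summable (\<lambda>n. (wt p n * R n) powr p)"
        "(\<Sum>n. (wt p n * R n) powr p) \<le> K * N"
        using avgL[rule_format, OF f Lf[unfolded Lp_finite_def]] unfolding N_def by blast
      obtain B where B: "tail_majorant ?a B" "summable (\<lambda>n. (wt p n * B n) powr p)"
        "(\<Sum>n. (wt p n * B n) powr p) \<le> G * (\<Sum>n. (wt p n * R n) powr p)"
        using gm[rule_format, OF GM R(1,2)] by blast
      have "(\<Sum>n. (wt p n * B n) powr p) \<le> G * (K * N)"
        using B(3) mult_left_mono[OF R(3), of G] G by linarith
      then have "2 * 2 powr \<bar>p - 2\<bar> * (\<Sum>n. (wt p n * B n) powr p) \<le> 2 * 2 powr \<bar>p - 2\<bar> * (G * (K * N))"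
        by (intro mult_left_mono) auto
      also have "\<dots> = D * N" by (simp add: D_def)
      finally show ?thesis
        using J_le_tail_majorant[OF assms(1) bd B(1,2)] unfolding J_def by linarith
    qed
    have to_L: "Lp_finite p f \<and> N \<le> E * J" if Jf: "J_star_finite p f"
    proof -
      obtain R where R: "avg_bound ?a R" "summable (\<lambda>n. (wt p n * R n) powr p)"
        "(\<Sum>n. (wt p n * R n) powr p) \<le> K' * J"
        using avgJ[rule_format, OF bd Jf[unfolded Jfin]] unfolding J_def by blast
      obtain B where B: "tail_majorant ?a B" "summable (\<lambda>n. (wt p n * B n) powr p)"
        "(\<Sum>n. (wt p n * B n) powr p) \<le> G * (\<Sum>n. (wt p n * R n) powr p)"
        using gm[rule_format, OF GM R(1,2)] by blast
      have "(\<Sum>n. (wt p n * B n) powr p) \<le> G * (K' * J)"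
        using B(3) mult_left_mono[OF R(3), of G] G by linarith
      then have "L * (\<Sum>n. (wt p n * B n) powr p) \<le> L * (G * (K' * J))"
        using L by (intro mult_left_mono) auto
      also have "\<dots> = E * J" by (simp add: E_def)
      finally have "L * (\<Sum>n. (wt p n * B n) powr p) \<le> E * J" .
      moreover have "set_integrable lborel circ (\<lambda>x. norm (f x) powr p) \<and> N \<le> L * (\<Sum>n. (wt p n * B n) powr p)"
        using Lp[rule_format, OF f B(1,2)] unfolding N_def .
      ultimately show ?thesis by (auto simp: Lp_finite_def)
    qed
    have "c1 * J_star p f \<le> Lp_norm p f \<and> Lp_norm p f \<le> c2 * J_star p f" if fin: "Lp_finite p f"
    proof
      have "J powr (1 / p) \<le> (D * N) powr (1 / p)"
        using to_J[OF fin] J0 assms by (intro powr_mono2) auto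
      then show "c1 * J_star p f \<le> Lp_norm p f"
        using D N0 by (simp add: Jst Nst c1_def powr_mult field_simps)
      have "N \<le> E * J" using to_L to_J[OF fin] Jfin by blast
      then have "N powr (1 / p) \<le> (E * J) powr (1 / p)"
        using N0 assms by (intro powr_mono2) auto
      also have "\<dots> = E powr (1 / p) * J powr (1 / p)"
        using E J0 by (simp add: powr_mult)
      also have "\<dots> \<le> c2 * J powr (1 / p)"
        by (intro mult_right_mono) (auto simp: c2_def)
      finally show "Lp_norm p f \<le> c2 * J_star p f" by (simp add: Jst Nst)
    qed
    then show ?thesis using to_J to_L Jfin by blast
  qed
  have "0 < c1" using D by (simp add: c1_def)
  moreover have "c1 \<le> c2" by (simp add: c2_def)
  ultimately show ?thesis using main by blast
qed

end
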